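(* Let $q\in\mathbb{C}$ be nonzero with $q^2\neq 1$, let $d\ge 0$ be an integer, let $V$ be a vector space over $\mathbb{C}$ of dimension $d+1$, and let $\Phi=(A;\{E_i\}_{i=0}^d;A^*;\{E^*_i\}_{i=0}^d)$ be a Leonard system on $V$ of dual $q$-Krawtchouk type, with parameters $h,h^*,\kappa,\kappa^*,\upsilon$. Fix $\epsilon\in\{1,-1\}$. Then there exists a unique $U_q(\mathfrak{sl}_2)$-module structure on $V$ such that on $V$ $$A=h1+\epsilon\kappa x+\epsilon\upsilon y,\qquad A^*=h^*1+\epsilon\kappa^* z .$$
   Context: A Leonard system on $V$ is a sequence $\Phi=(A;\{E_i\}_{i=0}^d;A^*;\{E^*_i\}_{i=0}^d)$ with: $A,A^*\in\mathrm{End}(V)$ each having $d+1$ distinct eigenvalues; $\{E_i\}$ an ordering of the primitive idempotents of $A$ (the projections onto the eigenspaces along the other eigenspaces) and $\{E^*_i\}$ an ordering of those of $A^*$; $E_iA^*E_j=0$ if $|i-j|>1$ and $\neq0$ if $|i-j|=1$; and $E^*_iAE^*_j=0$ if $|i-j|>1$ and $\neq 0$ if $|i-j|=1$ ($0\le i,j\le d$). Let $\theta_i$ (resp. $\theta^*_i$) be the eigenvalue of $A$ (resp. $A^*$) for $E_i$ (resp. $E^*_i$). For $0\le i\le d$ put $U_i=(E^*_0V+\dots+E^*_iV)\cap(E_iV+\dots+E_dV)$; each $U_i$ is one-dimensional and for $1\le i\le d$ the map $(A-\theta_{i-1}I)(A^*-\theta^*_iI)$ acts on $U_i$ as a nonzero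 scalar $\varphi_i$ (the first split sequence). The second split sequence $\{\phi_i\}_{i=1}^d$ is the first split sequence of the Leonard system $(A;\{E_{d-i}\}_{i=0}^d;A^*;\{E^*_i\}_{i=0}^d)$. $\Phi$ has dual $q$-Krawtchouk type if there are $h,h^*,\kappa,\kappa^*,\upsilon\in\mathbb{C}$ with $\kappa,\kappa^*,\upsilon\neq0$ such that $\theta_i=h+\kappa q^{d-2i}+\upsilon q^{2i-d}$, $\theta^*_i=h^*+\kappa^*q^{d-2i}$ ($0\le i\le d$), and $\varphi_i=\kappa\kappa^*q^{d+1-2i}(q^i-q^{-i})(q^{i-d-1}-q^{d+1-i})$, $\phi_i=\kappa^*\upsilon q^{d+1-2i}(q^i-q^{-i})(q^{i-d-1}-q^{d+1-i})$ ($1\le i\le d$). $U_q(\mathfrak{sl}_2)$ is the $\mathbb{C}$-algebra with generators $x,y,z^{\pm1}$ and relations $zz^{-1}=z^{-1}z=1$, $\frac{qxy-q^{-1}yx}{q-q^{-1}}=1$, $\frac{qyz-q^{-1}zy}{q-q^{-1}}=1$, $\frac{qzx-q^{-1}xz}{q-q^{-1}}=1$.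
   Formalization: Existence is proved in all cases, but uniqueness of the module structure is claimed only when it is not the case that d = 1 and q² = −1; in that excluded case a second module structure always exists, so uniqueness is false there. *)

theory Defs
  imports
    Complex_Main
    "HOL-Library.Poly_Mapping"
    "HOL-Library.FuncSet"
    "HOL-Algebra.QuotRing"
begin

section \<open>Leonard systems\<close>

text \<open>
  A complex vector space \<open>V\<close> is an additive group type \<open>'v\<close> together with a scalar multiplication
  \<open>scale\<close> satisfying \<^locale>\<open>vector_space\<close>; elements of \<open>End(V)\<close> are linear functions \<open>'v \<Rightarrow> 'v\<close>.
\<close>

definition eigenspace :: "(complex \<Rightarrow> 'v \<Rightarrow> 'v) \<Rightarrow> ('v \<Rightarrow> 'v) \<Rightarrow> complex \<Rightarrow> 'v set"
  where "eigenspace scale A \<theta> = {v. A v = scale \<theta> v}"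

definition eigenvalues :: "(complex \<Rightarrow> 'v::zero \<Rightarrow> 'v) \<Rightarrow> ('v \<Rightarrow> 'v) \<Rightarrow> complex set"
  where "eigenvalues scale A = {\<theta>. \<exists>v \<in> eigenspace scale A \<theta>. v \<noteq> 0}"

text \<open>
  \<open>P\<close> is the projection onto the \<open>\<theta>\<close>-eigenspace of \<open>A\<close> along the other eigenspaces. It is uniquely
  determined by this when \<open>V\<close> is the sum of the eigenspaces, which is the case for
  \<open>d + 1\<close> distinct eigenvalues in dimension \<open>d + 1\<close>.
\<close>

definition primitive_idempotent ::
    "(complex \<Rightarrow> 'v::ab_group_add \<Rightarrow> 'v) \<Rightarrow> ('v \<Rightarrow> 'v) \<Rightarrow> complex \<Rightarrow> ('v \<Rightarrow> 'v) \<Rightarrow> bool"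
  where "primitive_idempotent scale A \<theta> P \<longleftrightarrow>
    \<theta> \<in> eigenvalues scale A \<and> Vector_Spaces.linear scale scale P \<and>
    (\<forall>v \<in> eigenspace scale A \<theta>. P v = v) \<and>
    (\<forall>\<mu> \<in> eigenvalues scale A - {\<theta>}. \<forall>v \<in> eigenspace scale A \<mu>. P v = 0)"

definition eigenvalue_of ::
    "(complex \<Rightarrow> 'v::ab_group_add \<Rightarrow> 'v) \<Rightarrow> ('v \<Rightarrow> 'v) \<Rightarrow> ('v \<Rightarrow> 'v) \<Rightarrow> complex"
  where "eigenvalue_of scale A P = (THE \<theta>. primitive_idempotent scale A \<theta> P)"

definition leonard_system ::
    "(complex \<Rightarrow> 'v::ab_group_add \<Rightarrow> 'v) \<Rightarrow> nat \<Rightarrow> ('v \<Rightarrow> 'v) \<Rightarrow> (nat \<Rightarrow> 'v \<Rightarrow> 'v) \<Rightarrow>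
      ('v \<Rightarrow> 'v) \<Rightarrow> (nat \<Rightarrow> 'v \<Rightarrow> 'v) \<Rightarrow> bool"
  where "leonard_system scale d A E As Es \<longleftrightarrow>
    Vector_Spaces.linear scale scale A \<and> Vector_Spaces.linear scale scale As \<and>
    card (eigenvalues scale A) = d + 1 \<and> card (eigenvalues scale As) = d + 1 \<and>
    bij_betw E {0..d} {P. \<exists>\<theta>. primitive_idempotent scale A \<theta> P} \<and>
    bij_betw Es {0..d} {P. \<exists>\<theta>. primitive_idempotent scale As \<theta> P} \<and>
    (\<forall>i\<in>{0..d}. \<forall>j\<in>{0..d}.
      (\<bar>int i - int j\<bar> > 1 \<longrightarrow> E i \<circ> As \<circ> E j = (\<lambda>_. 0)) \<and>
      (\<bar>int i - int j\<bar> = 1 \<longrightarrow> E i \<circ> As \<circ> E j \<noteq> (\<lambda>_. 0))) \<and>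
    (\<forall>i\<in>{0..d}. \<forall>j\<in>{0..d}.
      (\<bar>int i - int j\<bar> > 1 \<longrightarrow> Es i \<circ> A \<circ> Es j = (\<lambda>_. 0)) \<and>
      (\<bar>int i - int j\<bar> = 1 \<longrightarrow> Es i \<circ> A \<circ> Es j \<noteq> (\<lambda>_. 0)))"

definition sum_of_ranges :: "(nat \<Rightarrow> 'v \<Rightarrow> 'v::comm_monoid_add) \<Rightarrow> nat set \<Rightarrow> 'v set"
  where "sum_of_ranges P J = {(\<Sum>j\<in>J. P j (f j)) | f. True}"

definition split_space ::
    "nat \<Rightarrow> (nat \<Rightarrow> 'v \<Rightarrow> 'v) \<Rightarrow> (nat \<Rightarrow> 'v \<Rightarrow> 'v) \<Rightarrow> nat \<Rightarrow> 'v::comm_monoid_add set"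
  where "split_space d E Es i = sum_of_ranges Es {0..i} \<inter> sum_of_ranges E {i..d}"

text \<open>
  The value at \<open>i\<close> is meaningful for \<open>1 \<le> i \<le> d\<close>; there the split space is one-dimensional,
  so that the scalar is unique.
\<close>

definition first_split_seq ::
    "(complex \<Rightarrow> 'v::ab_group_add \<Rightarrow> 'v) \<Rightarrow> nat \<Rightarrow> ('v \<Rightarrow> 'v) \<Rightarrow> (nat \<Rightarrow> 'v \<Rightarrow> 'v) \<Rightarrow>
      ('v \<Rightarrow> 'v) \<Rightarrow> (nat \<Rightarrow> 'v \<Rightarrow> 'v) \<Rightarrow> nat \<Rightarrow> complex"
  where "first_split_seq scale d A E As Es i =
    (THE c. \<forall>u \<in> split_space d E Es i.
       (let w = As u - scale (eigenvalue_of scale As (Es i)) u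
        in A w - scale (eigenvalue_of scale A (E (i - 1))) w) = scale c u)"

definition second_split_seq ::
    "(complex \<Rightarrow> 'v::ab_group_add \<Rightarrow> 'v) \<Rightarrow> nat \<Rightarrow> ('v \<Rightarrow> 'v) \<Rightarrow> (nat \<Rightarrow> 'v \<Rightarrow> 'v) \<Rightarrow>
      ('v \<Rightarrow> 'v) \<Rightarrow> (nat \<Rightarrow> 'v \<Rightarrow> 'v) \<Rightarrow> nat \<Rightarrow> complex"
  where "second_split_seq scale d A E As Es = first_split_seq scale d A (\<lambda>i. E (d - i)) As Es"

definition dual_q_Krawtchouk ::
    "(complex \<Rightarrow> 'v::ab_group_add \<Rightarrow> 'v) \<Rightarrow> complex \<Rightarrow> nat \<Rightarrow> ('v \<Rightarrow> 'v) \<Rightarrow> (nat \<Rightarrow> 'v \<Rightarrow> 'v) \<Rightarrow>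
      ('v \<Rightarrow> 'v) \<Rightarrow> (nat \<Rightarrow> 'v \<Rightarrow> 'v) \<Rightarrow>
      complex \<Rightarrow> complex \<Rightarrow> complex \<Rightarrow> complex \<Rightarrow> complex \<Rightarrow> bool"
  where "dual_q_Krawtchouk scale q d A E As Es h hs \<kappa> \<kappa>s \<upsilon> \<longleftrightarrow>
    \<kappa> \<noteq> 0 \<and> \<kappa>s \<noteq> 0 \<and> \<upsilon> \<noteq> 0 \<and>
    (\<forall>i\<in>{0..d}.
      eigenvalue_of scale A (E i) =
        h + \<kappa> * q powi (int d - 2 * int i) + \<upsilon> * q powi (2 * int i - int d) \<and>
      eigenvalue_of scale As (Es i) = hs + \<kappa>s * q powi (int d - 2 * int i)) \<and>
    (\<forall>i\<in>{1..d}.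
      first_split_seq scale d A E As Es i =
        \<kappa> * \<kappa>s * q powi (int d + 1 - 2 * int i) * (q powi int i - q powi (- int i)) *
          (q powi (int i - int d - 1) - q powi (int d + 1 - int i)) \<and>
      second_split_seq scale d A E As Es i =
        \<kappa>s * \<upsilon> * q powi (int d + 1 - 2 * int i) * (q powi int i - q powi (- int i)) *
          (q powi (int i - int d - 1) - q powi (int d + 1 - int i)))"


section \<open>The algebra \<open>U\<^sub>q(sl\<^sub>2)\<close> in its equitable presentation\<close>

datatype uq_gen = GenX | GenY | GenZ | GenZinv

text \<open>
  Words in the generators form a monoid, written additively so that the convolution product on
  finitely supported functions is the product of the free algebra.
\<close>

datatype uq_word = Word (letters: "uq_gen list")

instantiation uq_word :: monoid_add
begin

definition zero_uq_word :: uq_word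
  where "0 = Word []"

definition plus_uq_word :: "uq_word \<Rightarrow> uq_word \<Rightarrow> uq_word"
  where "u + v = Word (letters u @ letters v)"

instance
  by standard (simp_all add: zero_uq_word_def plus_uq_word_def)

end

type_synonym uq_free = "uq_word \<Rightarrow>\<^sub>0 complex"

definition free_scalar :: "complex \<Rightarrow> uq_free"
  where "free_scalar c = Poly_Mapping.single 0 c"

definition free_gen :: "uq_gen \<Rightarrow> uq_free"
  where "free_gen g = Poly_Mapping.single (Word [g]) 1"

definition free_alg :: "uq_free ring"
  where "free_alg = \<lparr>carrier = UNIV, mult = (*), one = 1, zero = 0, add = (+)\<rparr>"

definition q_bracket :: "complex \<Rightarrow> uq_free \<Rightarrow> uq_free \<Rightarrow> uq_free"
  where "q_bracket q a b =
    free_scalar (1 / (q - inverse q)) * (free_scalar q * a * b - free_scalar (inverse q) * b * a)"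

definition uq_relators :: "complex \<Rightarrow> uq_free set"
  where "uq_relators q =
    {free_gen GenZ * free_gen GenZinv - 1,
     free_gen GenZinv * free_gen GenZ - 1,
     q_bracket q (free_gen GenX) (free_gen GenY) - 1,
     q_bracket q (free_gen GenY) (free_gen GenZ) - 1,
     q_bracket q (free_gen GenZ) (free_gen GenX) - 1}"

definition uq_ideal :: "complex \<Rightarrow> uq_free set"
  where "uq_ideal q = genideal free_alg (uq_relators q)"

definition uq_sl2 :: "complex \<Rightarrow> uq_free set ring"
  where "uq_sl2 q = free_alg Quot uq_ideal q"

definition uq_class :: "complex \<Rightarrow> uq_free \<Rightarrow> uq_free set"
  where "uq_class q a = uq_ideal q +>\<^bsub>free_alg\<^esub> a"

definition uq_scalar :: "complex \<Rightarrow> complex \<Rightarrow> uq_free set"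
  where "uq_scalar q c = uq_class q (free_scalar c)"

definition uq_x :: "complex \<Rightarrow> uq_free set"
  where "uq_x q = uq_class q (free_gen GenX)"

definition uq_y :: "complex \<Rightarrow> uq_free set"
  where "uq_y q = uq_class q (free_gen GenY)"

definition uq_z :: "complex \<Rightarrow> uq_free set"
  where "uq_z q = uq_class q (free_gen GenZ)"

text \<open>
  A module structure on the vector space \<open>V\<close> is an algebra homomorphism \<open>\<rho>\<close> from the algebra to
  \<open>End(V)\<close>. Extensionality fixes the junk values of \<open>\<rho>\<close> outside the carrier, so that equality of
  module structures is equality of functions.
\<close>

definition uq_module_structure ::
    "(complex \<Rightarrow> 'v::ab_group_add \<Rightarrow> 'v) \<Rightarrow> complex \<Rightarrow> (uq_free set \<Rightarrow> 'v \<Rightarrow> 'v) \<Rightarrow> bool"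
  where "uq_module_structure scale q \<rho> \<longleftrightarrow>
    \<rho> \<in> extensional (carrier (uq_sl2 q)) \<and>
    (\<forall>a\<in>carrier (uq_sl2 q). Vector_Spaces.linear scale scale (\<rho> a)) \<and>
    (\<forall>a\<in>carrier (uq_sl2 q). \<forall>b\<in>carrier (uq_sl2 q). \<forall>v.
      \<rho> (a \<oplus>\<^bsub>uq_sl2 q\<^esub> b) v = \<rho> a v + \<rho> b v \<and>
      \<rho> (a \<otimes>\<^bsub>uq_sl2 q\<^esub> b) v = \<rho> a (\<rho> b v)) \<and>
    (\<forall>v. \<rho> \<one>\<^bsub>uq_sl2 q\<^esub> v = v) \<and>
    (\<forall>c v. \<rho> (uq_scalar q c) v = scale c v)"

text \<open>
  Pitfall: for \<open>d = 1\<close> and \<open>q\<^sup>2 = -1\<close> a module structure inducing a Leonard system of dual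
  \<open>q\<close>-Krawtchouk type need not be unique. With \<open>q = \<i>\<close>, \<open>h = hs = 0\<close>, \<open>\<kappa> = \<kappa>s = 1\<close>, \<open>\<upsilon> = 4\<close>, \<open>\<epsilon> = 1\<close>,
  \<open>As = diag(\<i>, -\<i>)\<close> and \<open>A\<close> with rows \<open>(-5\<i>, 4)\<close>, \<open>(4, 5\<i>)\<close>, both of the following pairs satisfy the
  relations together with \<open>z = As\<close>: \<open>x\<close> with rows \<open>(-\<i>, 0)\<close>, \<open>(4, \<i>)\<close> and \<open>y\<close> with rows
  \<open>(-\<i>, 1)\<close>, \<open>(0, \<i>)\<close>; or \<open>x\<close> with rows \<open>(-\<i>, 4)\<close>, \<open>(0, \<i>)\<close> and \<open>y\<close> with rows \<open>(-\<i>, 0)\<close>, \<open>(1, \<i>)\<close>.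
\<close>

end

theory Submission
  imports Defs
begin

text \<open>
  Existence. The split vectors \<open>u\<^sub>i = (A - \<theta>\<^sub>i\<^sub>-\<^sub>1) \<dots> (A - \<theta>\<^sub>0) u\<^sub>0\<close> with \<open>u\<^sub>0 \<in> E\<^sup>*\<^sub>0 V\<close> form a basis of \<open>V\<close>, and
  \<open>u\<^sub>i\<close> spans \<open>U\<^sub>i\<close>. In this basis \<open>A\<close> is lower bidiagonal with diagonal \<open>\<theta>\<^sub>i\<close> and subdiagonal \<open>1\<close>, and
  \<open>A\<^sup>*\<close> is upper bidiagonal with diagonal \<open>\<theta>\<^sup>*\<^sub>i\<close> and the first split sequence above it. Let \<open>y\<close> be diagonal with
  entries \<open>\<epsilon> q\<^sup>2\<^sup>i\<^sup>-\<^sup>d\<close> and solve the two required equations for \<open>x\<close> and \<open>z\<close>. The relations between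
  \<open>x, y\<close> and \<open>y, z\<close> then hold because consecutive diagonal entries differ by the factor \<open>q\<^sup>2\<close>, and the
  relation between \<open>z, x\<close> reduces to a first-order recurrence satisfied by the first split sequence.

  Uniqueness. The operator \<open>z\<close> is determined by \<open>A\<^sup>*\<close>. If \<open>(x, y)\<close> and \<open>(x', y')\<close> both work, then
  \<open>D = x - x'\<close> is a multiple of \<open>y - y'\<close>, so the relations give \<open>D z = q\<^sup>2 z D\<close> and \<open>q\<^sup>2 D z = z D\<close>. Hence
  \<open>(q\<^sup>4 - 1) z D = 0\<close>, and \<open>D = 0\<close> unless \<open>q\<^sup>2 = -1\<close>. In that case the \<open>\<theta>\<^sup>*\<^sub>i\<close> are distinct only for \<open>d \<le> 1\<close>,
  and for \<open>d = 0\<close> the operator \<open>z\<close> is a scalar, so that \<open>z D = D z = q\<^sup>2 z D\<close> forces \<open>D = 0\<close>.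
\<close>

section \<open>Modules over the equitable presentation\<close>

lemma ring_free_alg: "ring free_alg"
proof (rule ringI)
  show "abelian_group free_alg"
  proof (rule abelian_groupI)
    fix x :: uq_free
    show "\<exists>y\<in>carrier free_alg. y \<oplus>\<^bsub>free_alg\<^esub> x = \<zero>\<^bsub>free_alg\<^esub>"
      by (rule bexI[of _ "- x"]) (simp_all add: free_alg_def)
  qed (simp_all add: free_alg_def add_ac)
  show "Group.monoid free_alg"
    by (rule monoidI) (simp_all add: free_alg_def mult.assoc)
qed (simp_all add: free_alg_def algebra_simps)

lemma free_alg_minus [simp]: "\<ominus>\<^bsub>free_alg\<^esub> a = - a"
proof -
  interpret ring free_alg by (rule ring_free_alg)
  show ?thesis
    by (rule minus_equality) (simp_all add: free_alg_def)
qed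

lemma ideal_uq_ideal: "ideal (uq_ideal q) free_alg"
  unfolding uq_ideal_def
  by (rule ring.genideal_ideal[OF ring_free_alg]) (simp add: free_alg_def)

lemma uq_relators_in_ideal: "uq_relators q \<subseteq> uq_ideal q"
  unfolding uq_ideal_def
  by (rule ring.genideal_self[OF ring_free_alg]) (simp add: free_alg_def)

lemma uq_class_eq_iff: "uq_class q a = uq_class q b \<longleftrightarrow> a - b \<in> uq_ideal q"
proof -
  interpret I: ideal "uq_ideal q" free_alg by (rule ideal_uq_ideal)
  have carr: "x \<in> carrier free_alg" for x by (simp add: free_alg_def)
  have "uq_class q a = uq_class q b \<longleftrightarrow> a \<in> uq_class q b"
    unfolding uq_class_def
    by (metis I.a_repr_independence' I.a_repr_independenceD carr)
  also have "\<dots> \<longleftrightarrow> a \<oplus>\<^bsub>free_alg\<^esub> \<ominus>\<^bsub>free_alg\<^esub> b \<in> uq_ideal q"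
    unfolding uq_class_def by (rule I.a_rcos_module) (auto simp: carr)
  \<comment> \<open>Unfolding only the addition keeps \<open>free_alg\<close> intact inside the
    inverse, where \<open>free_alg_minus\<close> has to match.\<close>
  also have "a \<oplus>\<^bsub>free_alg\<^esub> \<ominus>\<^bsub>free_alg\<^esub> b = a - b"
    by (simp add: free_alg_def[THEN arg_cong[of _ _ "add"]])
  finally show ?thesis .
qed

lemma carrier_uq_sl2: "carrier (uq_sl2 q) = range (uq_class q)"
  by (auto simp: uq_sl2_def FactRing_def A_RCOSETS_def' uq_class_def free_alg_def a_r_coset_def)

lemma uq_class_add: "uq_class q a \<oplus>\<^bsub>uq_sl2 q\<^esub> uq_class q b = uq_class q (a + b)"
  using ring_hom_add[OF ideal.rcos_ring_hom[OF ideal_uq_ideal[of q]], of a b]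
  by (simp add: uq_sl2_def uq_class_def free_alg_def)

lemma uq_class_mult: "uq_class q a \<otimes>\<^bsub>uq_sl2 q\<^esub> uq_class q b = uq_class q (a * b)"
  using ring_hom_mult[OF ideal.rcos_ring_hom[OF ideal_uq_ideal[of q]], of a b]
  by (simp add: uq_sl2_def uq_class_def free_alg_def)

lemma uq_one: "\<one>\<^bsub>uq_sl2 q\<^esub> = uq_class q 1"
  using ring_hom_one[OF ideal.rcos_ring_hom[OF ideal_uq_ideal[of q]]]
  by (simp add: uq_sl2_def uq_class_def free_alg_def)

lemma free_single_Cons:
  "Poly_Mapping.single (Word (g # gs)) c = free_gen g * Poly_Mapping.single (Word gs) c"
  by (simp add: free_gen_def mult_single plus_uq_word_def)

text \<open>Every finitely supported function is a finite sum of single terms, so additive claims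
  about the free algebra reduce to scaled words.\<close>

lemma poly_mapping_single_induct [case_names zero single add]:
  fixes p :: "'a \<Rightarrow>\<^sub>0 'b::comm_monoid_add"
  assumes zero: "P 0" and single: "\<And>w c. P (Poly_Mapping.single w c)"
    and add: "\<And>a b. P a \<Longrightarrow> P b \<Longrightarrow> P (a + b)"
  shows "P p"
proof (induction p rule: update_induct)
  case const
  show ?case using zero by (simp add: zero_poly_mapping.abs_eq[symmetric])
next
  case (update f a b)
  \<comment> \<open>The key \<open>a\<close> lies outside the support of \<open>f\<close>, so
    overwriting there amounts to adding.\<close>
  have "Poly_Mapping.update a b f = f + Poly_Mapping.single a b"
    using update by (intro poly_mapping_eqI)
      (auto simp: lookup_update lookup_add lookup_single when_def in_keys_iff)
  then show ?case using update add single by simp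
qed

section \<open>From operators satisfying the relations to a module\<close>

primrec word_action :: "(uq_gen \<Rightarrow> 'v \<Rightarrow> 'v) \<Rightarrow> uq_gen list \<Rightarrow> 'v \<Rightarrow> 'v"
  where "word_action G [] v = v"
  | "word_action G (g # gs) v = G g (word_action G gs v)"

lemma word_action_append: "word_action G (us @ vs) v = word_action G us (word_action G vs v)"
  by (induction us) auto

text \<open>This is the evaluation homomorphism from the universal property of the free algebra,
  written out on finitely supported functions.\<close>

definition free_action ::
    "(complex \<Rightarrow> 'v::ab_group_add \<Rightarrow> 'v) \<Rightarrow> (uq_gen \<Rightarrow> 'v \<Rightarrow> 'v) \<Rightarrow> uq_free \<Rightarrow> 'v \<Rightarrow> 'v"
  where "free_action scale G p v =
    (\<Sum>w\<in>Poly_Mapping.keys p. scale (Poly_Mapping.lookup p w) (word_action G (letters w) v))"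

locale complex_vector_space = vector_space scale
  for scale :: "complex \<Rightarrow> 'v::ab_group_add \<Rightarrow> 'v"
begin

abbreviation "endo f \<equiv> Vector_Spaces.linear scale scale f"


lemma linear_endoI:
  assumes "\<And>v w. f (v + w) = f v + f w" "\<And>c v. f (scale c v) = scale c (f v)"
  shows "endo f"
  using assms by (intro Vector_Spaces.linear.intro module_hom.intro module_hom_axioms.intro)
    (auto intro: vector_space_axioms module_axioms)

end

lemma linear_compose_endo:
  "Vector_Spaces.linear s s f \<Longrightarrow> Vector_Spaces.linear s s g \<Longrightarrow>
    Vector_Spaces.linear s s (\<lambda>v. f (g v))"
  using Vector_Spaces.linear_compose[of s s g s f] by (simp add: o_def)

text \<open>The defining relations for four given operators, multiplied through by
  \<open>q - inverse q\<close>, which is nonzero because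
  \<open>q\<^sup>2 \<noteq> 1\<close>.\<close>

locale uq_representation = complex_vector_space scale
  for scale :: "complex \<Rightarrow> 'v::ab_group_add \<Rightarrow> 'v" +
  fixes q :: complex and G :: "uq_gen \<Rightarrow> 'v \<Rightarrow> 'v"
  assumes linear_gen: "Vector_Spaces.linear scale scale (G g)"
    and q_sq_ne_1: "q \<noteq> 0" "q\<^sup>2 \<noteq> 1"
    and z_zinv: "G GenZ (G GenZinv v) = v" "G GenZinv (G GenZ v) = v"
    and xy: "scale q (G GenX (G GenY v)) - scale (inverse q) (G GenY (G GenX v)) = scale (q - inverse q) v"
    and yz: "scale q (G GenY (G GenZ v)) - scale (inverse q) (G GenZ (G GenY v)) = scale (q - inverse q) v"
    and zx: "scale q (G GenZ (G GenX v)) - scale (inverse q) (G GenX (G GenZ v)) = scale (q - inverse q) v"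
begin

abbreviation "act \<equiv> free_action scale G"

lemma linear_word_action: "Vector_Spaces.linear scale scale (word_action G gs)"
proof (induction gs)
  case Nil
  show ?case by (rule linear_endoI) auto
next
  case (Cons g gs)
  then show ?case using linear_compose_endo[OF linear_gen Cons.IH] by simp
qed

text \<open>Zero coefficients contribute nothing, so the sums for different elements can run over a
  common index set.\<close>

lemma act_superset:
  assumes "finite S" "Poly_Mapping.keys p \<subseteq> S"
  shows "act p v = (\<Sum>w\<in>S. scale (Poly_Mapping.lookup p w) (word_action G (letters w) v))"
  unfolding free_action_def
  by (rule sum.mono_neutral_left) (use assms in \<open>auto simp: in_keys_iff\<close>)

lemma act_add: "act (a + b) v = act a v + act b v"
proof -
  let ?S = "Poly_Mapping.keys a \<union> Poly_Mapping.keys b"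
  have "Poly_Mapping.keys (a + b) \<subseteq> ?S" by (rule keys_add)
  then show ?thesis
    by (simp add: act_superset[of ?S] lookup_add scale_left_distrib sum.distrib)
qed

lemma act_zero [simp]: "act 0 v = 0"
  by (simp add: free_action_def)

lemma act_uminus: "act (- a) v = - act a v"
  using act_add[of "- a" a v] by (simp add: eq_neg_iff_add_eq_0)

lemma act_diff: "act (a - b) v = act a v - act b v"
  using act_add[of a "- b" v] by (simp add: act_uminus)

lemma act_single: "act (Poly_Mapping.single w c) v = scale c (word_action G (letters w) v)"
  by (subst act_superset[of "{w}"]) auto

lemma linear_act: "Vector_Spaces.linear scale scale (act p)"
proof (induction p rule: poly_mapping_single_induct)
  case zero
  show ?case by (rule linear_endoI) auto
next
  case (single w c)
  interpret L: Vector_Spaces.linear scale scale "word_action G (letters w)"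
    by (rule linear_word_action)
  show ?case
    by (rule linear_endoI) (auto simp: act_single L.add L.scale scale_right_distrib mult.commute)
next
  case (add a b)
  interpret a: Vector_Spaces.linear scale scale "act a" by (rule add)
  interpret b: Vector_Spaces.linear scale scale "act b" by (rule add)
  show ?case
    by (rule linear_endoI)
      (auto simp: act_add a.add b.add a.scale b.scale scale_right_distrib)
qed

text \<open>Both sides are additive in each factor; for two monomials, concatenation of words is
  composition of operators.\<close>

lemma act_mult: "act (a * b) v = act a (act b v)"
proof (induction a rule: poly_mapping_single_induct)
  case (single w c)
  interpret L: Vector_Spaces.linear scale scale "word_action G (letters w)"
    by (rule linear_word_action)
  show ?case
  proof (induction b rule: poly_mapping_single_induct)
    case (single u e)
    then show ?case
      by (simp add: mult_single act_single plus_uq_word_def word_action_append L.scale)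
  qed (simp_all add: act_add act_single L.add L.zero scale_right_distrib distrib_left)
qed (simp_all add: act_add distrib_right)

lemma act_one [simp]: "act 1 v = v"
  by (simp add: single_one[symmetric] act_single zero_uq_word_def del: single_one)

lemma act_scalar [simp]: "act (free_scalar c) v = scale c v"
  by (simp add: free_scalar_def act_single zero_uq_word_def)

lemma act_gen [simp]: "act (free_gen g) v = G g v"
  by (simp add: free_gen_def act_single)

lemma act_q_bracket:
  "act (q_bracket q a b) v =
    scale (1 / (q - inverse q)) (scale q (act a (act b v)) - scale (inverse q) (act b (act a v)))"
  by (simp add: q_bracket_def act_mult act_diff)

lemma act_relators:
  assumes "r \<in> uq_relators q"
  shows "act r v = 0"
proof -
  have "q - inverse q \<noteq> 0"
    using q_sq_ne_1 by (auto simp: field_simps power2_eq_square)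
  then show ?thesis
    using assms
    by (auto simp: uq_relators_def act_diff act_mult act_q_bracket z_zinv xy yz zx)
qed

text \<open>The elements acting as zero form a two-sided ideal containing the relators, hence
  containing the ideal they generate.\<close>

lemma act_ideal:
  assumes "a \<in> uq_ideal q"
  shows "act a v = 0"
proof -
  let ?K = "{a. \<forall>v. act a v = 0}"
  interpret L: Vector_Spaces.linear scale scale "act p" for p by (rule linear_act)
  have inv: "inv\<^bsub>add_monoid free_alg\<^esub> x = - x" for x
    using free_alg_minus[of x] by (simp only: a_inv_def)
  have "ideal ?K free_alg"
  proof (rule idealI[OF ring_free_alg])
    show "subgroup ?K (add_monoid free_alg)"
      proof (rule subgroup.intro)
      fix x assume "x \<in> ?K"
      then show "inv\<^bsub>add_monoid free_alg\<^esub> x \<in> ?K" by (simp only: inv mem_Collect_eq act_uminus) simp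
    qed (auto simp: free_alg_def act_add)
  qed (auto simp: free_alg_def act_mult L.zero)
  then have "uq_ideal q \<subseteq> ?K"
    unfolding uq_ideal_def
    by (rule ring.genideal_minimal[OF ring_free_alg]) (auto simp: act_relators)
  then show ?thesis using assms by auto
qed

text \<open>By \<open>act_ideal\<close> any representative of the coset serves. The restriction to
  the carrier provides the extensionality required of a module structure.\<close>

definition rep :: "uq_free set \<Rightarrow> 'v \<Rightarrow> 'v"
  where "rep = (\<lambda>C\<in>carrier (uq_sl2 q). act (SOME a. C = uq_class q a))"

lemma rep_class: "rep (uq_class q a) = act a"
proof -
  define b where "b = (SOME b. uq_class q a = uq_class q b)"
  have "uq_class q a = uq_class q b"
    unfolding b_def by (rule someI) (rule refl)
  then have "a - b \<in> uq_ideal q" by (simp add: uq_class_eq_iff)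
  then have "act (a - b) v = 0" for v by (rule act_ideal)
  then have "act b = act a" by (auto simp: act_diff fun_eq_iff)
  then show ?thesis by (simp add: rep_def carrier_uq_sl2 b_def)
qed

lemma uq_module_structure_rep: "uq_module_structure scale q rep"
  unfolding uq_module_structure_def
proof (intro conjI)
  show "rep \<in> extensional (carrier (uq_sl2 q))"
    unfolding rep_def by auto
qed (auto simp: carrier_uq_sl2 rep_class linear_act uq_class_add uq_class_mult uq_one
    act_add act_mult uq_scalar_def)

lemma rep_gens:
  "rep (uq_x q) = G GenX" "rep (uq_y q) = G GenY" "rep (uq_z q) = G GenZ"
  by (simp_all add: uq_x_def uq_y_def uq_z_def rep_class fun_eq_iff)

end

section \<open>From a module back to operators indexed by the free algebra\<close>

locale uq_module = complex_vector_space scale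
  for scale :: "complex \<Rightarrow> 'v::ab_group_add \<Rightarrow> 'v" +
  fixes q :: complex and \<rho> :: "uq_free set \<Rightarrow> 'v \<Rightarrow> 'v"
  assumes uq_module_structure: "uq_module_structure scale q \<rho>"
    and q_sq_ne_1: "q \<noteq> 0" "q\<^sup>2 \<noteq> 1"
begin

definition op :: "uq_free \<Rightarrow> 'v \<Rightarrow> 'v"
  where "op a = \<rho> (uq_class q a)"

lemma linear_op: "Vector_Spaces.linear scale scale (op a)"
  and op_add: "op (a + b) v = op a v + op b v"
  and op_mult: "op (a * b) v = op a (op b v)"
  and op_one [simp]: "op 1 v = v"
  and op_scalar [simp]: "op (free_scalar c) v = scale c v"
  using uq_module_structure
  by (simp_all add: uq_module_structure_def op_def carrier_uq_sl2 uq_one uq_scalar_def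
      flip: uq_class_add uq_class_mult)

lemma op_zero [simp]: "op 0 v = 0"
  using op_add[of 0 0 v] by simp

lemma op_diff: "op (a - b) v = op a v - op b v"
  using op_add[of "a - b" b v] by simp

lemma op_ideal:
  assumes "a \<in> uq_ideal q"
  shows "op a v = 0"
proof -
  have "uq_class q a = uq_class q 0" using assms by (simp add: uq_class_eq_iff)
  then have "op a = op 0" by (simp add: op_def)
  then show ?thesis by simp
qed

lemma op_q_bracket:
  assumes "q_bracket q a b - 1 \<in> uq_relators q"
  shows "scale q (op a (op b v)) - scale (inverse q) (op b (op a v)) = scale (q - inverse q) v"
proof -
  have "q - inverse q \<noteq> 0"
    using q_sq_ne_1 by (auto simp: field_simps power2_eq_square)
  moreover have "op (q_bracket q a b - 1) v = 0"
    using assms uq_relators_in_ideal op_ideal by blast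
  then have "scale (1 / (q - inverse q)) (scale q (op a (op b v)) - scale (inverse q) (op b (op a v))) = v"
    by (simp add: op_diff q_bracket_def op_mult)
  then have "scale (q - inverse q) (scale (1 / (q - inverse q))
      (scale q (op a (op b v)) - scale (inverse q) (op b (op a v)))) = scale (q - inverse q) v"
    by simp
  ultimately show ?thesis by (simp)
qed

lemma op_relations:
  "scale q (op (free_gen GenY) (op (free_gen GenZ) v))
    - scale (inverse q) (op (free_gen GenZ) (op (free_gen GenY) v)) = scale (q - inverse q) v"
  "scale q (op (free_gen GenZ) (op (free_gen GenX) v))
    - scale (inverse q) (op (free_gen GenX) (op (free_gen GenZ) v)) = scale (q - inverse q) v"
  by (rule op_q_bracket, simp add: uq_relators_def)+

lemma op_zinv:
  "op (free_gen GenZinv) (op (free_gen GenZ) v) = v"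
  "op (free_gen GenZ) (op (free_gen GenZinv) v) = v"
proof -
  have "op r v = 0" if "r \<in> uq_relators q" for r
    using that uq_relators_in_ideal op_ideal by blast
  from this[of "free_gen GenZinv * free_gen GenZ - 1"] this[of "free_gen GenZ * free_gen GenZinv - 1"]
  show "op (free_gen GenZinv) (op (free_gen GenZ) v) = v"
    "op (free_gen GenZ) (op (free_gen GenZinv) v) = v"
    by (simp_all add: uq_relators_def op_diff op_mult)
qed

end

text \<open>The operator of the inverse of \<open>z\<close> is forced, because two-sided inverses
  are unique. Agreement then passes from letters to words and to linear combinations, and
  extensionality settles the values off the carrier.\<close>

lemma uq_module_structure_eqI:
  fixes scale :: "complex \<Rightarrow> 'v::ab_group_add \<Rightarrow> 'v"
  assumes "uq_module scale q \<rho>" "uq_module scale q \<sigma>"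
    and "\<rho> (uq_x q) = \<sigma> (uq_x q)" "\<rho> (uq_y q) = \<sigma> (uq_y q)" "\<rho> (uq_z q) = \<sigma> (uq_z q)"
  shows "\<rho> = \<sigma>"
proof -
  interpret R: uq_module scale q \<rho> by fact
  interpret S: uq_module scale q \<sigma> by fact
  have z: "R.op (free_gen GenZ) = S.op (free_gen GenZ)"
    using assms(5) by (simp add: R.op_def S.op_def uq_z_def)
  have "R.op (free_gen GenZinv) v = S.op (free_gen GenZinv) v" for v
    by (metis R.op_zinv(1) S.op_zinv(2) z)
  then have gen: "R.op (free_gen g) = S.op (free_gen g)" for g
    using assms by (cases g) (auto simp: R.op_def S.op_def uq_x_def uq_y_def uq_z_def)
  have "R.op a v = S.op a v" for a v
  proof (induction a arbitrary: v rule: poly_mapping_single_induct)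
    case (single w c)
    have "R.op (Poly_Mapping.single (Word gs) c) v = S.op (Poly_Mapping.single (Word gs) c) v" for gs
    proof (induction gs arbitrary: v)
      case Nil
      show ?case
        using R.op_scalar[of c v] S.op_scalar[of c v] by (simp add: free_scalar_def zero_uq_word_def)
    next
      case (Cons g gs)
      then show ?case by (simp add: free_single_Cons R.op_mult S.op_mult gen)
    qed
    from this[of "letters w"] show ?case by simp
  qed (simp_all add: R.op_add S.op_add)
  then have "\<rho> C = \<sigma> C" if "C \<in> carrier (uq_sl2 q)" for C
    using that by (auto simp: carrier_uq_sl2 R.op_def S.op_def)
  moreover have "\<rho> \<in> extensional (carrier (uq_sl2 q))" "\<sigma> \<in> extensional (carrier (uq_sl2 q))"
    using R.uq_module_structure S.uq_module_structure by (auto simp: uq_module_structure_def)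
  ultimately show ?thesis by (intro extensionalityI[of \<rho> "carrier (uq_sl2 q)" \<sigma>]) simp_all
qed

section \<open>Eigenspace decompositions\<close>

context complex_vector_space
begin

section \<open>Linear maps determined by a spanning set, and independence of eigenvectors\<close>

lemma endo_simps:
  assumes "endo f"
  shows "f (v + w) = f v + f w" "f (v - w) = f v - f w" "f (scale c v) = scale c (f v)"
    "f 0 = 0" "f (sum g S) = (\<Sum>i\<in>S. f (g i))"
proof -
  interpret Vector_Spaces.linear scale scale f by fact
  show "f (v + w) = f v + f w" "f (v - w) = f v - f w" "f (scale c v) = scale c (f v)"
    "f 0 = 0" "f (sum g S) = (\<Sum>i\<in>S. f (g i))"
    by (simp_all add: add diff scale sum)
qed

lemma endo_eq_on_spanning:
  assumes "endo f" "endo g" "span B = UNIV" "\<And>b. b \<in> B \<Longrightarrow> f b = g b"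
  shows "f v = g v"
proof -
  interpret vector_space_pair scale scale by unfold_locales
  have "v \<in> span B" using assms(3) by simp
  from linear_eq_on[OF assms(1,2) this] assms(4) show ?thesis by auto
qed

text \<open>Applying \<open>A - ev k\<close> to a linear relation removes the term of
  \<open>k\<close> and multiplies every other coefficient by a nonzero \<open>ev b - ev k\<close>,
  which leaves a shorter relation.\<close>

lemma independent_eigenvectors:
  assumes A: "endo A" and B: "\<And>b. b \<in> B \<Longrightarrow> b \<noteq> 0 \<and> A b = scale (ev b) b"
    and inj: "inj_on ev B"
  shows "independent B"
proof -
  have zero: "u b = 0" if "finite T" "T \<subseteq> B" "(\<Sum>b\<in>T. scale (u b) b) = 0" "b \<in> T" for T u b
    using that
  proof (induction T arbitrary: u b rule: finite_induct)
    case (insert k T)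
    let ?s = "\<Sum>b\<in>T. scale (u b) b"
    have s: "scale (u k) k + ?s = 0" using insert by simp
    have "0 = A (scale (u k) k + ?s) - scale (ev k) (scale (u k) k + ?s)"
      by (simp only: s) (simp add: endo_simps[OF A])
    also have "\<dots> = A ?s - scale (ev k) ?s"
      using insert.prems B[of k] by (simp add: endo_simps[OF A] scale_right_distrib mult.commute)
    also have "\<dots> = (\<Sum>b\<in>T. scale (u b * (ev b - ev k)) b)"
      unfolding endo_simps[OF A] scale_sum_right sum_subtractf[symmetric]
      using insert.prems B by (intro sum.cong) (auto simp: algebra_simps)
    finally have "u b * (ev b - ev k) = 0" if "b \<in> T" for b
      using insert.IH[of "\<lambda>b. u b * (ev b - ev k)" b] insert.prems that by auto
    moreover have "ev b \<noteq> ev k" if "b \<in> T" for b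
      using inj_onD[OF inj, of b k] insert that by auto
    ultimately have T: "u b = 0" if "b \<in> T" for b using that by auto
    with s have "scale (u k) k = 0" by simp
    then have "u k = 0" using insert.prems B by auto
    with T insert.prems show ?case by auto
  qed simp
  show ?thesis
    unfolding independent_explicit_module using zero by blast
qed

end

locale complex_space = complex_vector_space scale
  for scale :: "complex \<Rightarrow> 'v::ab_group_add \<Rightarrow> 'v" +
  fixes d :: nat
  assumes dim_UNIV: "dim (UNIV :: 'v set) = d + 1"
begin

text \<open>Infinite sets have \<open>card\<close> zero, so the positive value \<open>d + 1\<close>
  of \<open>dim\<close> forces a basis to be finite.\<close>

lemma finite_basis: "\<exists>B. finite_dimensional_vector_space scale B"
proof -
  obtain B where B: "independent B" "UNIV \<subseteq> span B" "card B = dim (UNIV :: 'v set)"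
    using basis_exists[of UNIV] by blast
  then have "finite B" using dim_UNIV by (intro card_ge_0_finite) simp
  with B have "finite_dimensional_vector_space scale B"
    by unfold_locales auto
  then show ?thesis ..
qed

lemma independent_spans:
  assumes "independent B" "card B = d + 1"
  shows "span B = UNIV"
proof -
  obtain Bs where "finite_dimensional_vector_space scale Bs" using finite_basis ..
  then interpret finite_dimensional_vector_space scale Bs .
  show ?thesis
    using card_ge_dim_independent[of B UNIV] assms complex_space.dim_UNIV[OF complex_space_axioms] by auto
qed

lemma spanning_family:
  assumes "span (u ` {0..d}) = UNIV"
  shows "inj_on u {0..d}" "independent (u ` {0..d})"
proof -
  obtain Bs where "finite_dimensional_vector_space scale Bs" using finite_basis ..
  then interpret finite_dimensional_vector_space scale Bs .
  have dim: "dim (UNIV :: 'v set) = d + 1" 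
    by (rule complex_space.dim_UNIV[OF complex_space_axioms])
  have "d + 1 \<le> card (u ` {0..d})"
    using dim_le_card[of UNIV "u ` {0..d}"] dim assms by simp
  then have "card (u ` {0..d}) = card {0..d}"
    using card_image_le[of "{0..d}" u] by simp
  then show "inj_on u {0..d}" by (intro eq_card_imp_inj_on) auto
  show "independent (u ` {0..d})"
    using card_le_dim_spanning[of "u ` {0..d}" UNIV] dim assms card_image_le[of "{0..d}" u] by simp
qed

text \<open>\<open>P\<close> fixes the eigenvectors of its own eigenvalue and kills those of all
  others, so it cannot belong to two eigenvalues.\<close>

lemma eigenvalue_of_eq:
  assumes "primitive_idempotent scale A \<theta> P"
  shows "eigenvalue_of scale A P = \<theta>"
  unfolding eigenvalue_of_def
proof (rule the_equality)
  show "primitive_idempotent scale A \<theta> P" by fact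
next
  fix \<mu> assume \<mu>: "primitive_idempotent scale A \<mu> P"
  obtain v where v: "v \<in> eigenspace scale A \<mu>" "v \<noteq> 0"
    using \<mu> by (auto simp: primitive_idempotent_def eigenvalues_def)
  then have "P v = v" using \<mu> by (auto simp: primitive_idempotent_def)
  moreover have "P v = 0" if "\<mu> \<noteq> \<theta>"
    using assms \<mu> v that by (auto simp: primitive_idempotent_def)
  ultimately show "\<mu> = \<theta>" using v by auto
qed

end

text \<open>One half of a Leonard system together with a chosen eigenvector \<open>w i\<close> for
  each eigenvalue; it is instantiated once for \<open>A\<close> and once for
  \<open>As\<close>.\<close>

locale eigen_decomposition = complex_space scale d
  for scale :: "complex \<Rightarrow> 'v::ab_group_add \<Rightarrow> 'v" and d +
  fixes A :: "'v \<Rightarrow> 'v" and E :: "nat \<Rightarrow> 'v \<Rightarrow> 'v" and th :: "nat \<Rightarrow> complex" and w :: "nat \<Rightarrow> 'v"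
  assumes linear_A: "endo A" and linear_E: "i \<le> d \<Longrightarrow> endo (E i)"
    and inj_th: "inj_on th {0..d}"
    and w_nonzero: "i \<le> d \<Longrightarrow> w i \<noteq> 0"
    and A_w: "i \<le> d \<Longrightarrow> A (w i) = scale (th i) (w i)"
    and E_w: "i \<le> d \<Longrightarrow> j \<le> d \<Longrightarrow> E i (w j) = (if i = j then w j else 0)"
    and span_w: "span (w ` {0..d}) = UNIV"
begin

lemmas A_simps = endo_simps[OF linear_A]
lemmas E_simps = endo_simps[OF linear_E]

lemma endo_eqI:
  assumes "endo f" "endo g" "\<And>i. i \<le> d \<Longrightarrow> f (w i) = g (w i)"
  shows "f v = g v"
  by (rule endo_eq_on_spanning[OF assms(1,2) span_w]) (auto simp: assms(3))

lemma linear_sum_E: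
  assumes "J \<subseteq> {0..d}"
  shows "endo (\<lambda>v. \<Sum>i\<in>J. scale (c i) (E i v))"
proof (rule linear_endoI)
  fix v v' a
  have J: "i \<le> d" if "i \<in> J" for i using assms that by auto
  show "(\<Sum>i\<in>J. scale (c i) (E i (v + v'))) =
      (\<Sum>i\<in>J. scale (c i) (E i v)) + (\<Sum>i\<in>J. scale (c i) (E i v'))"
    by (simp add: E_simps J scale_right_distrib sum.distrib)
  show "(\<Sum>i\<in>J. scale (c i) (E i (scale a v))) = scale a (\<Sum>i\<in>J. scale (c i) (E i v))"
    by (simp add: E_simps J scale_sum_right mult.commute)
qed

lemma sum_E_w:
  assumes "j \<le> d"
  shows "(\<Sum>i\<in>{0..d}. scale (c i) (E i (w j))) = scale (c j) (w j)"
proof -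
  have "(\<Sum>i\<in>{0..d}. scale (c i) (E i (w j))) = (\<Sum>i\<in>{0..d}. if i = j then scale (c j) (w j) else 0)"
    using assms by (intro sum.cong) (auto simp: E_w)
  then show ?thesis using assms by simp
qed

lemma sum_E: "(\<Sum>i\<in>{0..d}. E i v) = v"
proof -
  have "(\<Sum>i\<in>{0..d}. scale 1 (E i v)) = v"
    by (rule endo_eqI[OF linear_sum_E]) (auto simp: sum_E_w[where c = "\<lambda>_. 1", simplified] intro: linear_endoI)
  then show ?thesis by simp
qed

lemma E_E:
  assumes "i \<le> d" "j \<le> d"
  shows "E i (E j v) = (if i = j then E j v else 0)"
proof (cases "i = j")
  case True
  have "E i (E j v) = E j v"
    by (rule endo_eqI[OF linear_compose_endo]) (use assms in \<open>auto simp: linear_E E_w E_simps True\<close>)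
  then show ?thesis using True by simp
next
  case False
  have "E i (E j v) = 0"
    by (rule endo_eqI[OF linear_compose_endo, where g = "\<lambda>_. 0"])
      (use assms False in \<open>auto simp: linear_E E_w E_simps intro: linear_endoI\<close>)
  then show ?thesis using False by simp
qed

lemma E_A:
  assumes "i \<le> d"
  shows "E i (A v) = scale (th i) (E i v)"
proof (rule endo_eqI[where f = "\<lambda>v. E i (A v)" and g = "\<lambda>v. scale (th i) (E i v)"])
  show "endo (\<lambda>v. E i (A v))" by (rule linear_compose_endo) (use assms linear_A linear_E in auto)
  show "endo (\<lambda>v. scale (th i) (E i v))"
    using linear_sum_E[of "{i}"] assms by simp
qed (use assms in \<open>auto simp: A_w E_w E_simps\<close>)

lemma E_multiple:
  assumes "i \<le> d"
  shows "\<exists>c. E i v = scale c (w i)"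
proof -
  have "v \<in> span (w ` {0..d})" using span_w by simp
  then show ?thesis
  proof (induction rule: span_induct_alt)
    case base
    show ?case using assms by (intro exI[of _ 0]) (simp add: E_simps)
  next
    case (step c x y)
    from step obtain j where "x = w j" "j \<le> d" by auto
    moreover from step obtain e where "E i y = scale e (w i)" by blast
    ultimately show ?case
      using assms by (intro exI[of _ "(if i = j then c else 0) + e"])
        (auto simp: E_simps E_w scale_left_distrib)
  qed
qed

lemma eq_0I:
  assumes "\<And>i. i \<le> d \<Longrightarrow> E i v = 0"
  shows "v = 0"
  using sum_E[of v] assms by simp

text \<open>Orthogonality and completeness of the idempotents turn membership in a split space into
  the vanishing of components.\<close>

lemma sum_of_ranges_iff:
  assumes "J \<subseteq> {0..d}"
  shows "v \<in> sum_of_ranges E J \<longleftrightarrow> (\<forall>j\<le>d. j \<notin> J \<longrightarrow> E j v = 0)"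
proof
  assume "v \<in> sum_of_ranges E J"
  then obtain f where v: "v = (\<Sum>j\<in>J. E j (f j))" by (auto simp: sum_of_ranges_def)
  show "\<forall>j\<le>d. j \<notin> J \<longrightarrow> E j v = 0"
  proof (intro allI impI)
    fix j assume j: "j \<le> d" "j \<notin> J"
    then have "E j v = (\<Sum>k\<in>J. E j (E k (f k)))" by (simp add: v E_simps)
    also have "\<dots> = 0"
    proof (intro sum.neutral ballI)
      fix k assume "k \<in> J"
      with j assms show "E j (E k (f k)) = 0" by (subst E_E) auto
    qed
    finally show "E j v = 0" .
  qed
next
  assume 0: "\<forall>j\<le>d. j \<notin> J \<longrightarrow> E j v = 0"
  have "v = (\<Sum>j\<in>{0..d}. E j v)" by (simp add: sum_E)
  also have "\<dots> = (\<Sum>j\<in>J. E j v)"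
    by (rule sum.mono_neutral_right) (use assms 0 in auto)
  finally show "v \<in> sum_of_ranges E J" by (auto simp: sum_of_ranges_def)
qed

end

context complex_space
begin

text \<open>One eigenvector for each of the \<open>d + 1\<close> eigenvalues gives a basis, on which
  a primitive idempotent is determined by its eigenvalue. So injectivity of \<open>E\<close> passes
  to the eigenvalues, and counting shows that they exhaust the spectrum.\<close>

lemma eigen_decomposition_exists:
  assumes A: "endo A" and card: "card (eigenvalues scale A) = d + 1"
    and bij: "bij_betw E {0..d} {P. \<exists>\<theta>. primitive_idempotent scale A \<theta> P}"
  shows "\<exists>w. eigen_decomposition scale d A E (\<lambda>i. eigenvalue_of scale A (E i)) w"
proof -
  define th where "th i = eigenvalue_of scale A (E i)" for i
  have prim: "primitive_idempotent scale A (th i) (E i)" if "i \<le> d" for i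
    using bij_betwE[OF bij] that eigenvalue_of_eq by (fastforce simp: th_def)
  have "\<forall>\<theta>\<in>eigenvalues scale A. \<exists>v. A v = scale \<theta> v \<and> v \<noteq> 0"
    by (auto simp: eigenvalues_def eigenspace_def)
  then obtain W where W: "\<And>\<theta>. \<theta> \<in> eigenvalues scale A \<Longrightarrow> A (W \<theta>) = scale \<theta> (W \<theta>) \<and> W \<theta> \<noteq> 0"
    by metis
  let ?B = "W ` eigenvalues scale A"
  have injW: "inj_on W (eigenvalues scale A)"
    using W by (intro inj_onI) (metis scale_right_imp_eq)
  have "independent ?B"
    by (rule independent_eigenvectors[OF A, of _ "inv_into (eigenvalues scale A) W"])
      (use W injW in \<open>auto simp: inv_into_f_f inj_on_inv_into\<close>)
  then have span: "span ?B = UNIV"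
    using injW card by (intro independent_spans) (simp_all add: card_image)
  have same: "E i = E j" if "i \<le> d" "j \<le> d" "th i = th j" for i j
  proof
    fix v
    show "E i v = E j v"
    proof (rule endo_eq_on_spanning[where f = "E i" and g = "E j", OF _ _ span])
      fix b assume "b \<in> ?B"
      then obtain \<theta> where \<theta>: "\<theta> \<in> eigenvalues scale A" "b = W \<theta>" by auto
      then have "b \<in> eigenspace scale A \<theta>" using W by (auto simp: eigenspace_def)
      then show "E i b = E j b"
        using prim[OF that(1)] prim[OF that(2)] that(3) \<theta>
        by (cases "\<theta> = th i") (auto simp: primitive_idempotent_def)
    qed (use prim that in \<open>auto simp: primitive_idempotent_def\<close>)
  qed
  have inj: "inj_on th {0..d}"
  proof (rule inj_onI)
    fix i j assume "i \<in> {0..d}" "j \<in> {0..d}" "th i = th j"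
    then show "i = j"
      using same[of i j] inj_onD[OF bij_betw_imp_inj_on[OF bij], of i j] by auto
  qed
  have ev: "th i \<in> eigenvalues scale A" if "i \<le> d" for i
    using prim[OF that] by (auto simp: primitive_idempotent_def)
  have "th ` {0..d} = eigenvalues scale A"
  proof (rule card_subset_eq)
    show "finite (eigenvalues scale A)" using card by (intro card_ge_0_finite) simp
  qed (use ev card in \<open>auto simp: card_image[OF inj]\<close>)
  then have B: "?B = (\<lambda>i. W (th i)) ` {0..d}" by (simp add: image_image flip: \<open>th ` {0..d} = _\<close>)
  have "eigen_decomposition scale d A E th (\<lambda>i. W (th i))"
  proof (intro eigen_decomposition.intro eigen_decomposition_axioms.intro complex_space_axioms)
    fix i j assume ij: "i \<le> d" "j \<le> d"
    have "W (th j) \<in> eigenspace scale A (th j)" using W[OF ev[OF ij(2)]] by (auto simp: eigenspace_def)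
    moreover have "th i = th j \<longleftrightarrow> i = j" using inj_on_eq_iff[OF inj] ij by auto
    ultimately show "E i (W (th j)) = (if i = j then W (th j) else 0)"
      using prim[OF ij(1)] ev[OF ij(2)] by (auto simp: primitive_idempotent_def)
  qed (use W ev A inj span B prim in \<open>auto simp: primitive_idempotent_def\<close>)
  then show ?thesis by (auto simp: th_def[abs_def])
qed

end

section \<open>The split basis\<close>

text \<open>In terms of levels, \<open>A\<close> raises the \<open>Es\<close> level by at most one
  and does so nontrivially at each step, while \<open>As\<close> lowers the \<open>E\<close> level
  by at most one.\<close>

locale split_system =
  P: eigen_decomposition scale d A E th w + D: eigen_decomposition scale d As Es ths ws
  for scale :: "complex \<Rightarrow> 'v::ab_group_add \<Rightarrow> 'v" and d A E th w As Es ths ws +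
  assumes tridiag_As: "i \<le> d \<Longrightarrow> j \<le> d \<Longrightarrow> i + 1 < j \<Longrightarrow> E i (As (E j v)) = 0"
    and tridiag_A: "i \<le> d \<Longrightarrow> j \<le> d \<Longrightarrow> j + 1 < i \<Longrightarrow> Es i (A (Es j v)) = 0"
    and irred_A: "Suc i \<le> d \<Longrightarrow> \<exists>v. Es (Suc i) (A (Es i v)) \<noteq> 0"
begin

primrec u :: "nat \<Rightarrow> 'v"
  where "u 0 = ws 0"
  | "u (Suc i) = A (u i) - scale (th i) (u i)"

lemma A_u: "A (u i) = scale (th i) (u i) + u (Suc i)"
  by simp

lemma Es_u_above: "j \<le> d \<Longrightarrow> i < j \<Longrightarrow> Es j (u i) = 0"
proof (induction i arbitrary: j)
  case 0
  then show ?case by (simp add: D.E_w)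
next
  case (Suc i)
  have "Es j (A (u i)) = Es j (A (\<Sum>k\<in>{0..d}. Es k (u i)))" by (simp add: D.sum_E)
  also have "\<dots> = (\<Sum>k\<in>{0..d}. Es j (A (Es k (u i))))"
    using Suc.prems by (simp add: P.A_simps D.E_simps)
  also have "\<dots> = 0"
  proof (intro sum.neutral ballI)
    fix k assume k: "k \<in> {0..d}"
    show "Es j (A (Es k (u i))) = 0"
    proof (cases "k \<le> i")
      case True
      then show ?thesis using tridiag_A[of j k] Suc.prems k by simp
    next
      case False
      then show ?thesis using Suc.IH[of k] Suc.prems k by (simp add: P.A_simps D.E_simps)
    qed
  qed
  finally show ?case using Suc by (simp add: D.E_simps)
qed

text \<open>The top component of \<open>u (Suc i)\<close> comes from that of \<open>u i\<close>
  alone: lower levels cannot reach \<open>Suc i\<close>, and higher ones are absent. Irreducibility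
  on the line of \<open>ws i\<close> keeps it nonzero.\<close>

lemma Es_u_diag: "i \<le> d \<Longrightarrow> Es i (u i) \<noteq> 0"
proof (induction i)
  case 0
  then show ?case using D.w_nonzero[of 0] by (simp add: D.E_w)
next
  case (Suc i)
  obtain c where c: "Es i (u i) = scale c (ws i)" using D.E_multiple[of i] Suc by auto
  with Suc have "c \<noteq> 0" by auto
  obtain v where v: "Es (Suc i) (A (Es i v)) \<noteq> 0" using irred_A Suc by blast
  obtain e where "Es i v = scale e (ws i)" using D.E_multiple[of i] Suc by auto
  with v Suc.prems have ws: "Es (Suc i) (A (ws i)) \<noteq> 0" by (auto simp: P.A_simps D.E_simps)
  have "Es (Suc i) (A (u i)) = Es (Suc i) (A (\<Sum>k\<in>{0..d}. Es k (u i)))" by (simp only: D.sum_E)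
  also have "\<dots> = (\<Sum>k\<in>{0..d}. Es (Suc i) (A (Es k (u i))))"
    using Suc.prems by (simp add: P.A_simps D.E_simps)
  also have "\<dots> = (\<Sum>k\<in>{0..d}. if k = i then Es (Suc i) (A (Es k (u i))) else 0)"
  proof (intro sum.cong refl)
    fix k assume k: "k \<in> {0..d}"
    consider "k < i" | "k = i" | "k > i" by linarith
    then show "Es (Suc i) (A (Es k (u i))) = (if k = i then Es (Suc i) (A (Es k (u i))) else 0)"
      using tridiag_A[of "Suc i" k] Es_u_above[of k i] k Suc.prems
      by cases (auto simp: P.A_simps D.E_simps)
  qed
  also have "\<dots> = scale c (Es (Suc i) (A (ws i)))"
    using Suc.prems by (simp add: c P.A_simps D.E_simps)
  finally show ?case using Suc.prems ws \<open>c \<noteq> 0\<close> Es_u_above[of "Suc i" i] by (simp add: D.E_simps)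
qed

text \<open>On components under \<open>E j\<close> each factor \<open>A - th k\<close> acts as the
  scalar \<open>th j - th k\<close>.\<close>

lemma E_u:
  assumes "j \<le> d"
  shows "E j (u i) = scale (\<Prod>k<i. th j - th k) (E j (u 0))"
proof (induction i)
  case (Suc i)
  then show ?case using assms
    by (simp add: P.E_simps P.E_A P.scale_left_diff_distrib algebra_simps)
qed simp

text \<open>The product in \<open>E_u\<close> contains the zero factor \<open>k = j\<close>.\<close>

lemma E_u_below: "j \<le> d \<Longrightarrow> j < i \<Longrightarrow> E j (u i) = 0"
  by (subst E_u) auto

lemma u_beyond: "u (Suc d) = 0"
  by (rule P.eq_0I) (simp add: E_u_below del: u.simps)

text \<open>Expressed in the basis \<open>ws\<close>, the vectors \<open>u i\<close> form a
  triangular matrix with nonzero diagonal by \<open>Es_u_diag\<close>; it is inverted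
  recursively.\<close>

lemma ws_in_span: "i \<le> d \<Longrightarrow> ws i \<in> P.span (u ` {0..i})"
proof (induction i rule: less_induct)
  case (less i)
  obtain c where c: "Es i (u i) = scale c (ws i)" using D.E_multiple[of i] less by auto
  have "c \<noteq> 0" using Es_u_diag[of i] less c by auto
  have "(\<Sum>k\<in>{0..d}. Es k (u i)) = (\<Sum>k\<in>{0..i}. Es k (u i))"
    by (rule sum.mono_neutral_right) (use less.prems in \<open>auto simp: Es_u_above\<close>)
  also have "{0..i} = insert i {0..<i}" by auto
  finally have "scale c (ws i) + (\<Sum>k\<in>{0..<i}. Es k (u i)) = u i" by (simp add: c D.sum_E)
  then have u: "scale c (ws i) = u i - (\<Sum>k\<in>{0..<i}. Es k (u i))"
    by (rule add_implies_diff)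
  have "Es k (u i) \<in> P.span (u ` {0..i})" if k: "k < i" for k
  proof -
    obtain e where "Es k (u i) = scale e (ws k)" using D.E_multiple[of k] less k by auto
    moreover have "ws k \<in> P.span (u ` {0..i})"
      using less.IH[OF k] less.prems k P.span_mono[of "u ` {0..k}" "u ` {0..i}"] by fastforce
    ultimately show ?thesis by (simp add: P.span_scale)
  qed
  then have "scale c (ws i) \<in> P.span (u ` {0..i})"
    unfolding u by (intro P.span_diff P.span_sum) (auto intro: P.span_base)
  from P.span_scale[OF this, of "1 / c"] show ?case using \<open>c \<noteq> 0\<close> by simp
qed

lemma in_span_u:
  assumes "i \<le> d" "\<And>j. j \<le> d \<Longrightarrow> i < j \<Longrightarrow> Es j v = 0"
  shows "v \<in> P.span (u ` {0..i})"
proof -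
  have "Es k v \<in> P.span (u ` {0..i})" if k: "k \<le> d" for k
  proof (cases "k \<le> i")
    case True
    obtain e where "Es k v = scale e (ws k)" using D.E_multiple[of k] k by auto
    moreover have "ws k \<in> P.span (u ` {0..i})"
      using ws_in_span[OF k] True P.span_mono[of "u ` {0..k}" "u ` {0..i}"] by fastforce
    ultimately show ?thesis by (simp add: P.span_scale)
  qed (use assms that P.span_zero in auto)
  then have "(\<Sum>k\<in>{0..d}. Es k v) \<in> P.span (u ` {0..i})" by (intro P.span_sum) auto
  then show ?thesis by (simp add: D.sum_E)
qed

lemma span_u: "P.span (u ` {0..d}) = UNIV"
  using in_span_u[of d] by auto

text \<open>Since the eigenvalues are distinct, a zero here would make \<open>E i\<close> kill
  \<open>u 0\<close>, hence every \<open>u j\<close>. These span the space, yet \<open>E i\<close>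
  fixes \<open>w i\<close>.\<close>

lemma E_u_diag:
  assumes "i \<le> d"
  shows "E i (u i) \<noteq> 0"
proof
  assume "E i (u i) = 0"
  moreover have "(\<Prod>k<i. th i - th k) \<noteq> 0"
    using assms inj_on_eq_iff[OF P.inj_th, of i] by auto
  ultimately have "E i (u 0) = 0" using E_u[OF assms, of i] by simp
  then have "E i (u j) = 0" for j using E_u[OF assms, of j] by simp
  then have "E i (w i) = 0"
    by (intro P.endo_eq_on_spanning[where f = "E i" and g = "\<lambda>_. 0" and v = "w i",
          OF P.linear_E[OF assms] P.linear_endoI span_u]) auto
  then show False using P.w_nonzero[OF assms] assms by (simp add: P.E_w)
qed

text \<open>The coefficients of \<open>u 0\<close>, \<open>u 1\<close>, and so on are removed in
  turn: \<open>E k\<close> kills all later vectors but not \<open>u k\<close>, so it isolates the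
  coefficient of \<open>u k\<close>.\<close>

lemma multiple_of_u:
  assumes "i \<le> d" "v \<in> P.span (u ` {0..i})" "\<And>j. j < i \<Longrightarrow> E j v = 0"
  shows "\<exists>c. v = scale c (u i)"
proof -
  have "k \<le> i \<Longrightarrow> v \<in> P.span (u ` {k..i})" for k
  proof (induction k)
    case 0
    show ?case using assms by simp
  next
    case (Suc k)
    have "{k..i} = insert k {Suc k..i}" using Suc.prems by auto
    then obtain a where a: "v - scale a (u k) \<in> P.span (u ` {Suc k..i})"
      using Suc P.span_breakdown_eq[of v "u k" "u ` {Suc k..i}"] by auto
    have k: "k \<le> d" using Suc.prems assms by simp
    from a have "E k (v - scale a (u k)) = 0"
    proof (induction rule: P.span_induct_alt)
      case (step c x y)
      then show ?case using k by (auto simp: P.E_simps E_u_below simp del: u.simps)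
    qed (simp add: P.E_simps k)
    then have "a = 0" using assms(3)[of k] E_u_diag[OF k] Suc.prems k by (simp add: P.E_simps)
    then show ?case using a by simp
  qed
  from this[of i] show ?thesis by (auto simp: P.span_singleton)
qed

lemma split_space_eq:
  assumes "i \<le> d"
  shows "split_space d E Es i = range (\<lambda>c. scale c (u i))"
proof (intro equalityI subsetI)
  fix v assume "v \<in> split_space d E Es i"
  then have *: "\<forall>j\<le>d. j \<notin> {0..i} \<longrightarrow> Es j v = 0" "\<forall>j\<le>d. j \<notin> {i..d} \<longrightarrow> E j v = 0"
    using assms by (simp_all add: split_space_def P.sum_of_ranges_iff D.sum_of_ranges_iff)
  have "\<exists>c. v = scale c (u i)"
    by (rule multiple_of_u[OF assms in_span_u[OF assms]]) (use * assms in auto)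
  then show "v \<in> range (\<lambda>c. scale c (u i))" by auto
next
  fix v assume "v \<in> range (\<lambda>c. scale c (u i))"
  then show "v \<in> split_space d E Es i"
    using assms
    by (auto simp: split_space_def P.sum_of_ranges_iff D.sum_of_ranges_iff P.E_simps D.E_simps
        E_u_below Es_u_above)
qed

lemma As_u_0: "As (u 0) = scale (ths 0) (u 0)"
  by (simp add: D.A_w)

text \<open>Subtracting \<open>ths (Suc i)\<close> removes the top \<open>Es\<close> component, and
  \<open>As\<close> lowers the \<open>E\<close> level by at most one, so the result lies in the line
  of \<open>u i\<close>.\<close>

lemma As_u_Suc:
  assumes "Suc i \<le> d"
  shows "\<exists>c. As (u (Suc i)) - scale (ths (Suc i)) (u (Suc i)) = scale c (u i)"
proof (rule multiple_of_u[OF _ in_span_u])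
  let ?v = "As (u (Suc i)) - scale (ths (Suc i)) (u (Suc i))"
  show "Es j ?v = 0" if "j \<le> d" "i < j" for j
    using that Es_u_above[of j "Suc i"] assms
    by (cases "j = Suc i") (simp_all add: D.E_simps D.E_A del: u.simps)
  show "E j ?v = 0" if "j < i" for j
  proof -
    have j: "j \<le> d" using that assms by simp
    have "E j (As (u (Suc i))) = E j (As (\<Sum>k\<in>{0..d}. E k (u (Suc i))))" by (simp only: P.sum_E)
    also have "\<dots> = (\<Sum>k\<in>{0..d}. E j (As (E k (u (Suc i)))))"
      using j by (simp add: D.A_simps P.E_simps del: u.simps)
    also have "\<dots> = 0"
    proof (intro sum.neutral ballI)
      fix k assume "k \<in> {0..d}"
      then show "E j (As (E k (u (Suc i)))) = 0"
        using tridiag_As[of j k "u (Suc i)"] E_u_below[of k "Suc i"] that j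
        by (cases "k \<le> i") (simp_all add: D.A_simps P.E_simps del: u.simps)
    qed
    finally show ?thesis using E_u_below[of j "Suc i"] that j by (simp add: P.E_simps del: u.simps)
  qed
qed (use assms in auto)

lemma u_nonzero: "i \<le> d \<Longrightarrow> u i \<noteq> 0"
  using E_u_diag[of i] P.E_simps(4)[of i] by auto

text \<open>The scalar from \<open>As_u_Suc\<close> is the split sequence entry, because
  \<open>A - th i\<close> carries \<open>u i\<close> back to \<open>u (Suc i)\<close> with
  coefficient 1.\<close>

lemma As_u:
  assumes th: "\<And>i. i \<le> d \<Longrightarrow> th i = eigenvalue_of scale A (E i)"
    and ths: "\<And>i. i \<le> d \<Longrightarrow> ths i = eigenvalue_of scale As (Es i)"
    and i: "Suc i \<le> d"
  shows "As (u (Suc i)) = scale (ths (Suc i)) (u (Suc i))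
    + scale (first_split_seq scale d A E As Es (Suc i)) (u i)"
proof -
  obtain c where c: "As (u (Suc i)) - scale (ths (Suc i)) (u (Suc i)) = scale c (u i)"
    using As_u_Suc[OF i] by auto
  have *: "A w - scale (th i) w = scale (c * a) (u (Suc i))"
    if "w = As (scale a (u (Suc i))) - scale (ths (Suc i)) (scale a (u (Suc i)))" for w a
  proof -
    have "w = scale a (As (u (Suc i)) - scale (ths (Suc i)) (u (Suc i)))"
      using that by (simp add: D.A_simps P.scale_right_diff_distrib mult.commute del: u.simps)
    then have "w = scale (c * a) (u i)" by (simp add: c mult.commute del: u.simps)
    then show ?thesis by (simp add: P.A_simps P.scale_right_diff_distrib mult.commute)
  qed
  have "first_split_seq scale d A E As Es (Suc i) = c"
    unfolding first_split_seq_def Let_def split_space_eq[OF i]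
  proof (rule the_equality)
    fix e assume "\<forall>v\<in>range (\<lambda>c. scale c (u (Suc i))).
      A (As v - scale (eigenvalue_of scale As (Es (Suc i))) v)
        - scale (eigenvalue_of scale A (E (Suc i - 1)))
            (As v - scale (eigenvalue_of scale As (Es (Suc i))) v) = scale e v"
    from bspec[OF this rangeI[of _ 1]]
    have "scale e (u (Suc i)) = scale c (u (Suc i))"
      using *[OF refl, of 1] i by (simp add: th ths del: u.simps)
    then show "e = c" using u_nonzero[OF i] by (simp del: u.simps)
  qed (use * i in \<open>auto simp: th ths simp del: u.simps\<close>)
  with c show ?thesis by (simp add: algebra_simps del: u.simps)
qed

end

section \<open>The equitable generators on the split basis\<close>

context complex_space
begin

text \<open>In the application \<open>p i\<close> is \<open>q powi (d - 2 i)\<close> and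
  \<open>f i\<close> is the split sequence divided by \<open>\<kappa> * \<kappa>s\<close>. Comparing
  coefficients on the split basis, off-diagonal terms cancel by \<open>p_Suc\<close>, and the
  diagonal of the last relation is \<open>f_rec\<close>.\<close>

lemma equitable_relations:
  fixes q \<kappa> \<epsilon> :: complex and p f :: "nat \<Rightarrow> complex"
  assumes X: "endo X" and Y: "endo Y" and Z: "endo Z"
    and span_u: "span (u ` {0..d}) = UNIV" and u_beyond: "u (Suc d) = 0"
    and q: "q \<noteq> 0" and \<kappa>: "\<kappa> \<noteq> 0" and \<epsilon>: "\<epsilon> * \<epsilon> = 1"
    and p: "\<And>i. p i \<noteq> 0" and p_Suc: "\<And>i. p (Suc i) = p i / q\<^sup>2"
    and f_0: "f 0 = 0" and f_beyond: "f (Suc d) = 0"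
    and f_rec: "\<And>i. (q - inverse q) * (p i)\<^sup>2 + q * f (Suc i) - inverse q * f i = q - inverse q"
    and X_u: "\<And>i. i \<le> d \<Longrightarrow> X (u i) = scale (\<epsilon> * p i) (u i) + scale (\<epsilon> / \<kappa>) (u (Suc i))"
    and Y_u: "\<And>i. i \<le> d \<Longrightarrow> Y (u i) = scale (\<epsilon> / p i) (u i)"
    and Z_u: "\<And>i. i \<le> d \<Longrightarrow> Z (u i) = scale (\<epsilon> * p i) (u i) + scale (\<epsilon> * \<kappa> * f i) (u (i - 1))"
  shows "scale q (X (Y v)) - scale (inverse q) (Y (X v)) = scale (q - inverse q) v" (is ?xy)
    and "scale q (Y (Z v)) - scale (inverse q) (Z (Y v)) = scale (q - inverse q) v" (is ?yz)
    and "scale q (Z (X v)) - scale (inverse q) (X (Z v)) = scale (q - inverse q) v" (is ?zx)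
proof -
  note XYZ = endo_simps[OF X] endo_simps[OF Y] endo_simps[OF Z]
  have \<epsilon>2: "\<epsilon> * (\<epsilon> * c) = c" for c using \<epsilon> by (simp flip: mult.assoc)
  \<comment> \<open>The formulas for \<open>Y\<close> and \<open>Z\<close> persist one index past
    the basis: at \<open>i = d\<close> all terms vanish, since \<open>u (Suc d)\<close> and
    \<open>f (Suc d)\<close> are zero.\<close>
  have Y_u': "Y (u (Suc i)) = scale (\<epsilon> / p (Suc i)) (u (Suc i))" if "i \<le> d" for i
    using Y_u[of "Suc i"] that u_beyond by (cases "i = d") (auto simp: XYZ)
  have Z_u': "Z (u (Suc i)) = scale (\<epsilon> * p (Suc i)) (u (Suc i)) + scale (\<epsilon> * \<kappa> * f (Suc i)) (u i)"
    if "i \<le> d" for i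
    using Z_u[of "Suc i"] that u_beyond f_beyond by (cases "i = d") (auto simp: XYZ)
  have spanI: "g v = scale (q - inverse q) v" if "endo g"
    "\<And>i. i \<le> d \<Longrightarrow> g (u i) = scale (q - inverse q) (u i)" for g
    by (rule endo_eq_on_spanning[where f = g and g = "scale (q - inverse q)", OF that(1) linear_endoI span_u])
      (use that(2) in \<open>auto simp: scale_right_distrib mult.commute\<close>)
  have endo_bracket: "endo (\<lambda>v. scale q (f (g v)) - scale (inverse q) (g (f v)))"
    if "endo f" "endo g" for f g
    by (rule linear_endoI)
      (simp_all add: endo_simps[OF that(1)] endo_simps[OF that(2)] scale_right_distrib
        scale_right_diff_distrib mult.commute)
  show ?xy
  proof (rule spanI[OF endo_bracket[OF X Y]])
    fix i assume i: "i \<le> d"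
    have "scale q (X (Y (u i))) - scale (inverse q) (Y (X (u i)))
        = scale (q * (\<epsilon> / p i) * (\<epsilon> * p i) - inverse q * (\<epsilon> * p i) * (\<epsilon> / p i)) (u i)
          + scale (q * (\<epsilon> / p i) * (\<epsilon> / \<kappa>) - inverse q * (\<epsilon> / \<kappa>) * (\<epsilon> / p (Suc i))) (u (Suc i))"
      using i by (simp add: X_u Y_u Y_u' XYZ scale_right_distrib scale_left_diff_distrib mult.assoc)
    also have "q * (\<epsilon> / p i) * (\<epsilon> * p i) - inverse q * (\<epsilon> * p i) * (\<epsilon> / p i) = q - inverse q"
      using p[of i] q by (simp add: field_simps \<epsilon>2 \<epsilon>)
    also have "q * (\<epsilon> / p i) * (\<epsilon> / \<kappa>) - inverse q * (\<epsilon> / \<kappa>) * (\<epsilon> / p (Suc i)) = 0"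
      using p[of i] q \<kappa> by (simp add: p_Suc field_simps power2_eq_square)
    finally show "scale q (X (Y (u i))) - scale (inverse q) (Y (X (u i))) = scale (q - inverse q) (u i)"
      by simp
  qed
  show ?yz
  proof (rule spanI[OF endo_bracket[OF Y Z]])
    fix i assume i: "i \<le> d"
    have "scale q (Y (Z (u i))) - scale (inverse q) (Z (Y (u i)))
        = scale (q * (\<epsilon> * p i) * (\<epsilon> / p i) - inverse q * (\<epsilon> / p i) * (\<epsilon> * p i)) (u i)
          + scale (q * (\<epsilon> * \<kappa> * f i) * (\<epsilon> / p (i - 1)) - inverse q * (\<epsilon> / p i) * (\<epsilon> * \<kappa> * f i)) (u (i - 1))"
      using i by (simp add: Y_u Z_u XYZ scale_right_distrib scale_left_diff_distrib mult.assoc)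
    also have "q * (\<epsilon> * p i) * (\<epsilon> / p i) - inverse q * (\<epsilon> / p i) * (\<epsilon> * p i) = q - inverse q"
      using p[of i] q by (simp add: field_simps \<epsilon>2 \<epsilon>)
    \<comment> \<open>For \<open>i = 0\<close> the truncated index \<open>i - 1\<close> is 0 again,
      and \<open>f 0 = 0\<close> removes the spurious term.\<close>
    also have "q * (\<epsilon> * \<kappa> * f i) * (\<epsilon> / p (i - 1)) - inverse q * (\<epsilon> / p i) * (\<epsilon> * \<kappa> * f i) = 0"
      using p[of "i - 1"] q by (cases i) (simp_all add: f_0 p_Suc field_simps power2_eq_square)
    finally show "scale q (Y (Z (u i))) - scale (inverse q) (Z (Y (u i))) = scale (q - inverse q) (u i)"
      by simp
  qed
  show ?zx
  proof (rule spanI[OF endo_bracket[OF Z X]])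
    fix i assume i: "i \<le> d"
    have 1: "scale q (Z (X (u i))) = scale (q * (p i)\<^sup>2 + q * f (Suc i)) (u i)
        + scale (q * p i * f i * \<kappa>) (u (i - 1)) + scale (q * p (Suc i) / \<kappa>) (u (Suc i))"
      using i \<kappa> by (simp add: X_u Z_u Z_u' XYZ scale_right_distrib scale_left_distrib
          \<epsilon>2 power2_eq_square mult_ac)
    have 2: "scale (inverse q) (X (Z (u i))) = scale (inverse q * (p i)\<^sup>2 + inverse q * f i) (u i)
        + scale (q * p i * f i * \<kappa>) (u (i - 1)) + scale (q * p (Suc i) / \<kappa>) (u (Suc i))"
    proof (cases i)
      case 0
      have "inverse q * p 0 = q * p (Suc 0)" using q by (simp add: p_Suc field_simps power2_eq_square)
      then show ?thesis using 0 X_u[of 0]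
        by (simp add: f_0 Z_u XYZ scale_right_distrib scale_left_distrib \<epsilon>2 power2_eq_square mult_ac)
    next
      case (Suc j)
      have *: "inverse q * p j = q * p (Suc j)" "inverse q * p (Suc j) = q * p (Suc (Suc j))"
        using q by (simp_all add: p_Suc field_simps power2_eq_square)
      have "X (Z (u i)) = scale ((p i)\<^sup>2 + f i) (u i) + scale (p j * f i * \<kappa>) (u j)
          + scale (p i / \<kappa>) (u (Suc i))"
        using Suc i X_u[of i] X_u[of j] Z_u[of i] \<kappa>
        by (simp add: XYZ scale_right_distrib scale_left_distrib \<epsilon>2 power2_eq_square mult_ac)
      then have "scale (inverse q) (X (Z (u i))) =
          scale (inverse q * ((p i)\<^sup>2 + f i)) (u i) + scale ((inverse q * p j) * f i * \<kappa>) (u j)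
          + scale ((inverse q * p (Suc j)) / \<kappa>) (u (Suc i))"
        by (simp add: scale_right_distrib mult.assoc Suc)
      then show ?thesis unfolding * by (simp add: Suc distrib_left)
    qed
    have "scale q (Z (X (u i))) - scale (inverse q) (X (Z (u i)))
        = scale ((q - inverse q) * (p i)\<^sup>2 + q * f (Suc i) - inverse q * f i) (u i)"
      unfolding 1 2 by (simp add: algebra_simps)
    then show "scale q (Z (X (u i))) - scale (inverse q) (X (Z (u i))) = scale (q - inverse q) (u i)"
      by (simp only: f_rec)
  qed
qed

end

text \<open>The factored form exhibits the zeros at \<open>i = 0\<close> and
  \<open>i = d + 1\<close> and makes the recurrence a rational identity in \<open>q\<close> and the
  values of \<open>p\<close>.\<close>

lemma split_weight_eq:
  fixes q :: complex and d i :: nat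
  assumes "q \<noteq> 0"
  defines "p \<equiv> \<lambda>i. q powi (int d - 2 * int i)"
  shows "q powi (int d + 1 - 2 * int i) * (q powi int i - q powi (- int i)) *
      (q powi (int i - int d - 1) - q powi (int d + 1 - int i)) =
    (1 - p i / p 0) * (1 - p i * p 0 * q\<^sup>2)"
proof -
  have pi: "q powi (a - 2 * int i) = q powi a / (q powi int i)\<^sup>2" for a
    using assms by (simp add: power_int_diff power_int_mult mult.commute[of 2])
  have "q powi (int i - int d - 1) = q powi int i / (q powi int d * q)"
    "q powi (int d + 1 - int i) = q powi int d * q / q powi int i"
    "q powi (int d + 1) = q powi int d * q"
    using assms by (simp_all add: power_int_diff power_int_add)
  moreover have "q powi int i \<noteq> 0" "q powi int d \<noteq> 0" using assms by simp_all
  ultimately show ?thesis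
    using assms(1) unfolding p_def pi
    by (simp add: power_int_minus field_simps power2_eq_square)
qed

context split_system
begin

lemma uq_representation_exists:
  fixes q h hs \<kappa> \<kappa>s \<upsilon> \<epsilon> :: complex
  assumes q: "q \<noteq> 0" "q\<^sup>2 \<noteq> 1" and nz: "\<kappa> \<noteq> 0" "\<kappa>s \<noteq> 0" and \<epsilon>: "\<epsilon> \<in> {1, -1}"
    and th_eq: "\<And>i. i \<le> d \<Longrightarrow> th i = h + \<kappa> * q powi (int d - 2 * int i) + \<upsilon> * q powi (2 * int i - int d)"
    and ths_eq: "\<And>i. i \<le> d \<Longrightarrow> ths i = hs + \<kappa>s * q powi (int d - 2 * int i)"
    and As_u: "\<And>i. Suc i \<le> d \<Longrightarrow>
      As (u (Suc i)) = scale (ths (Suc i)) (u (Suc i)) + scale (\<phi> (Suc i)) (u i)"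
    and \<phi>: "\<And>i. i \<in> {1..d} \<Longrightarrow> \<phi> i = \<kappa> * \<kappa>s * q powi (int d + 1 - 2 * int i) *
      (q powi int i - q powi (- int i)) * (q powi (int i - int d - 1) - q powi (int d + 1 - int i))"
  shows "\<exists>G. uq_representation scale q G \<and>
    (\<forall>v. A v = scale h v + scale (\<epsilon> * \<kappa>) (G GenX v) + scale (\<epsilon> * \<upsilon>) (G GenY v)) \<and>
    (\<forall>v. As v = scale hs v + scale (\<epsilon> * \<kappa>s) (G GenZ v))"
proof -
  have \<epsilon>1: "\<epsilon> * \<epsilon> = 1" "\<epsilon> \<noteq> 0" using \<epsilon> by auto
  have \<epsilon>2: "\<epsilon> * (\<epsilon> * c) = c" for c using \<epsilon>1 by (simp flip: mult.assoc)
  define p where "p i = q powi (int d - 2 * int i)" for i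
  define f where "f i = (1 - p i / p 0) * (1 - p i * p 0 * q\<^sup>2)" for i
  have p: "p i \<noteq> 0" for i using q by (simp add: p_def)
  have p_inv: "q powi (2 * int i - int d) = 1 / p i" for i
    using power_int_minus_divide[of q "int d - 2 * int i"] by (simp add: p_def)
  have p_Suc: "p (Suc i) = p i / q\<^sup>2" for i
  proof -
    have "p (Suc i) = q powi ((int d - 2 * int i) - 2)" by (simp add: p_def algebra_simps)
    also have "\<dots> = p i / q\<^sup>2" using q by (subst power_int_diff) (auto simp: p_def)
    finally show ?thesis .
  qed
  have "p (Suc d) * p 0 * q\<^sup>2 = p d * p 0" using q by (simp add: p_Suc)
  also have "\<dots> = 1" using q by (simp add: p_def power_int_minus)
  finally have f_beyond: "f (Suc d) = 0" by (simp add: f_def)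
  have f_rec: "(q - inverse q) * (p i)\<^sup>2 + q * f (Suc i) - inverse q * f i = q - inverse q" for i
    using q p[of 0] by (simp add: f_def p_Suc field_simps power2_eq_square)
  have \<phi>_eq: "\<phi> i = \<kappa> * \<kappa>s * f i" if "i \<in> {1..d}" for i
    using split_weight_eq[of q d i] q by (simp add: \<phi>[OF that] f_def p_def mult.assoc)
  note basis = P.spanning_family[OF span_u]
  interpret VP: vector_space_pair scale scale by unfold_locales
  \<comment> \<open>The extension theorem prescribes values on vectors, so the index is recovered by
    \<open>inv_into\<close>, using that \<open>u\<close> is injective on
    \<open>{0..d}\<close>.\<close>
  obtain Y where Y: "P.endo Y"
    and "\<forall>x\<in>u ` {0..d}. Y x = scale (\<epsilon> / p (inv_into {0..d} u x)) x"
    using VP.linear_independent_extend[OF basis(2), of "\<lambda>x. scale (\<epsilon> / p (inv_into {0..d} u x)) x"]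
    by blast
  then have Y_u: "Y (u i) = scale (\<epsilon> / p i) (u i)" if "i \<le> d" for i
    using that basis(1) by (simp add: inv_into_f_f)
  \<comment> \<open>The two required equations are solved for \<open>x\<close> and \<open>z\<close>;
    dividing by \<open>\<epsilon>\<close> is multiplying by it.\<close>
  define X where "X v = scale (\<epsilon> / \<kappa>) (A v - scale h v - scale (\<epsilon> * \<upsilon>) (Y v))" for v
  define Z where "Z v = scale (\<epsilon> / \<kappa>s) (As v - scale hs v)" for v
  \<comment> \<open>Invertibility is visible on the eigenbasis \<open>ws\<close> of
    \<open>As\<close>, where \<open>Z\<close> is diagonal with entries
    \<open>\<epsilon> * p i\<close>.\<close>
  define Zinv where "Zinv v = (\<Sum>i\<in>{0..d}. scale (\<epsilon> / p i) (Es i v))" for v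
  have X: "P.endo X"
    unfolding X_def
    by (rule P.linear_endoI)
      (simp_all add: P.A_simps P.endo_simps[OF Y] P.scale_right_distrib P.scale_right_diff_distrib mult_ac)
  have Z: "P.endo Z"
    unfolding Z_def
    by (rule P.linear_endoI)
      (simp_all add: D.A_simps P.scale_right_distrib P.scale_right_diff_distrib mult_ac)
  have Zinv: "P.endo Zinv"
    using D.linear_sum_E[of "{0..d}" "\<lambda>i. \<epsilon> / p i"] by (simp add: Zinv_def[abs_def])
  have X_u: "X (u i) = scale (\<epsilon> * p i) (u i) + scale (\<epsilon> / \<kappa>) (u (Suc i))" if "i \<le> d" for i
  proof -
    have "A (u i) - scale h (u i) - scale (\<epsilon> * \<upsilon>) (Y (u i)) = scale (\<kappa> * p i) (u i) + u (Suc i)"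
      unfolding A_u th_eq[OF that] Y_u[OF that] p_inv p_def[symmetric]
      by (simp add: P.scale_left_distrib \<epsilon>2 mult_ac del: u.simps)
    then show ?thesis using nz by (simp add: X_def P.scale_right_distrib del: u.simps)
  qed
  have Z_u: "Z (u i) = scale (\<epsilon> * p i) (u i) + scale (\<epsilon> * \<kappa> * f i) (u (i - 1))" if "i \<le> d" for i
  proof (cases i)
    case 0
    have "f 0 = 0" using p by (simp add: f_def)
    then show ?thesis using nz ths_eq[of 0] As_u_0
      by (simp add: 0 Z_def P.scale_left_distrib p_def)
  next
    case (Suc j)
    have "As (u i) - scale hs (u i) = scale (\<kappa>s * p i) (u i) + scale (\<kappa> * \<kappa>s * f i) (u j)"
      using As_u[of j] that \<phi>_eq[of i] ths_eq[of i]
      by (simp add: Suc P.scale_left_distrib p_def del: u.simps)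
    then show ?thesis using nz by (simp add: Z_def Suc P.scale_right_distrib mult_ac del: u.simps)
  qed
  have Z_ws: "Z (ws i) = scale (\<epsilon> * p i) (ws i)" if "i \<le> d" for i
    using nz that by (simp add: Z_def D.A_w ths_eq p_def P.scale_left_distrib)
  have Zinv_ws: "Zinv (ws i) = scale (\<epsilon> / p i) (ws i)" if "i \<le> d" for i
    using that by (simp add: Zinv_def D.sum_E_w)
  have id: "P.endo (\<lambda>v. v)" by (rule P.linear_endoI) simp_all
  have ZZinv: "Z (Zinv v) = v" for v
    by (rule D.endo_eqI[where f = "\<lambda>v. Z (Zinv v)" and g = "\<lambda>v. v", OF linear_compose_endo[OF Z Zinv] id])
      (simp add: Z_ws Zinv_ws P.endo_simps[OF Z] p \<epsilon>1)
  have ZinvZ: "Zinv (Z v) = v" for v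
    by (rule D.endo_eqI[where f = "\<lambda>v. Zinv (Z v)" and g = "\<lambda>v. v", OF linear_compose_endo[OF Zinv Z] id])
      (simp add: Z_ws Zinv_ws P.endo_simps[OF Zinv] p \<epsilon>1)
  have f_0: "f 0 = 0" using p by (simp add: f_def)
  note rels = P.equitable_relations[where u = u and p = p and f = f, 
    OF X Y Z span_u u_beyond q(1) nz(1) \<epsilon>1(1) p p_Suc f_0 f_beyond f_rec
    X_u Y_u Z_u]
  define G where "G g = (case g of GenX \<Rightarrow> X | GenY \<Rightarrow> Y | GenZ \<Rightarrow> Z | GenZinv \<Rightarrow> Zinv)" for g
  have "uq_representation scale q G"
  proof (intro uq_representation.intro uq_representation_axioms.intro)
    show "P.endo (G g)" for g by (cases g) (simp_all add: G_def X Y Z Zinv)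
  qed (simp_all only: G_def uq_gen.case ZZinv ZinvZ rels q not_False_eq_True
      P.complex_vector_space_axioms)
  moreover have "A v = scale h v + scale (\<epsilon> * \<kappa>) (X v) + scale (\<epsilon> * \<upsilon>) (Y v)" for v
    using nz \<epsilon>1 by (simp add: X_def)
  moreover have "As v = scale hs v + scale (\<epsilon> * \<kappa>s) (Z v)" for v
    using nz \<epsilon>1 by (simp add: Z_def)
  ultimately show ?thesis by (intro exI[of _ G]) (simp add: G_def)
qed

end

section \<open>Uniqueness and the main theorem\<close>

lemma uq_module_structure_unique:
  fixes scale :: "complex \<Rightarrow> 'v::ab_group_add \<Rightarrow> 'v"
  assumes "uq_module scale q \<rho>" "uq_module scale q \<sigma>"
    and nz: "a \<noteq> 0" "b \<noteq> 0" "c \<noteq> 0"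
    and \<rho>: "\<And>v. A v = scale h v + scale a (\<rho> (uq_x q) v) + scale b (\<rho> (uq_y q) v)"
      "\<And>v. As v = scale hs v + scale c (\<rho> (uq_z q) v)"
    and \<sigma>: "\<And>v. A v = scale h v + scale a (\<sigma> (uq_x q) v) + scale b (\<sigma> (uq_y q) v)"
      "\<And>v. As v = scale hs v + scale c (\<sigma> (uq_z q) v)"
    and non_deg: "q ^ 4 \<noteq> 1 \<or> (\<exists>e. \<forall>v. As v = scale e v)"
  shows "\<rho> = \<sigma>"
proof -
  interpret R: uq_module scale q \<rho> by fact
  interpret S: uq_module scale q \<sigma> by fact
  define X Y X' Y' Z Zi where defs:
    "X = R.op (free_gen GenX)" "Y = R.op (free_gen GenY)"
    "X' = S.op (free_gen GenX)" "Y' = S.op (free_gen GenY)"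
    "Z = R.op (free_gen GenZ)" "Zi = R.op (free_gen GenZinv)"
  have class_eqs: "\<rho> (uq_x q) = X" "\<rho> (uq_y q) = Y" "\<rho> (uq_z q) = Z"
    "\<sigma> (uq_x q) = X'" "\<sigma> (uq_y q) = Y'" "\<sigma> (uq_z q) = S.op (free_gen GenZ)"
    by (simp_all add: defs R.op_def S.op_def uq_x_def uq_y_def uq_z_def)
  have "S.op (free_gen GenZ) v = Z v" for v
    using \<rho>(2)[of v] \<sigma>(2)[of v] nz by (simp add: class_eqs)
  then have SZ: "S.op (free_gen GenZ) = Z" by auto
  note lin = R.endo_simps[OF R.linear_op, of "free_gen GenZ", folded defs]
  define D where "D v = X v - X' v" for v
  have aD: "scale a (D v) = scale b (Y' v - Y v)" for v
    using \<rho>(1)[of v] \<sigma>(1)[of v] by (simp add: class_eqs D_def R.scale_right_diff_distrib algebra_simps)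
  then have D_Y: "scale (b / a) (Y' v - Y v) = D v" for v
    using nz
    by (metis R.scale_scale R.scale_one divide_self_if mult.commute times_divide_eq_left times_divide_eq_right)
  \<comment> \<open>Both structures share \<open>z\<close> and the right-hand sides of the
    relations, so subtraction leaves homogeneous relations for the differences.\<close>
  have ZD: "scale q (Z (D v)) = scale (inverse q) (D (Z v))" for v
    using trans[OF R.op_relations(2)[of v] S.op_relations(2)[of v, symmetric]]
    unfolding SZ by (simp add: D_def lin R.scale_right_diff_distrib algebra_simps flip: defs)
  have ZY: "scale q (Y' (Z v) - Y (Z v)) = scale (inverse q) (Z (Y' v - Y v))" for v
    using trans[OF R.op_relations(1)[of v] S.op_relations(1)[of v, symmetric]]
    unfolding SZ by (simp add: lin R.scale_right_diff_distrib algebra_simps flip: defs)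
  have DZ: "scale q (D (Z v)) = scale (inverse q) (Z (D v))" for v
    using ZY[of v, THEN arg_cong[of _ _ "scale (b / a)"]]
    by (simp add: D_Y[symmetric] lin mult.commute)
  have DZ': "D (Z v) = scale (q\<^sup>2) (Z (D v))" for v
    using ZD[of v, THEN arg_cong[of _ _ "scale q"]] R.q_sq_ne_1
    by (simp add: power2_eq_square)
  have "Z (D v) = 0" for v
    using non_deg
  proof
    assume "q ^ 4 \<noteq> 1"
    have "scale (q ^ 4) (Z (D v)) = Z (D v)"
      using DZ[of v, THEN arg_cong[of _ _ "scale q"]] R.q_sq_ne_1
      by (simp add: DZ' power2_eq_square power4_eq_xxxx mult.assoc)
    then have "scale (q ^ 4 - 1) (Z (D v)) = 0" by (simp add: R.scale_left_diff_distrib)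
    with \<open>q ^ 4 \<noteq> 1\<close> show ?thesis by simp
  next
    assume "\<exists>e. \<forall>v. As v = scale e v"
    then obtain e where e: "\<And>v. As v = scale e v" by auto
    have Z: "Z v = scale ((e - hs) / c) v" for v
    proof -
      have "scale c (Z v) = scale (e - hs) v"
        using \<rho>(2)[of v] by (simp add: e class_eqs R.scale_left_diff_distrib)
      from arg_cong[OF this, of "scale (1 / c)"] show ?thesis using nz by simp
    qed
    have "D (scale k v) = scale k (D v)" for k v
      by (simp add: D_def defs R.endo_simps[OF R.linear_op] R.endo_simps[OF S.linear_op]
          R.scale_right_diff_distrib)
    then have "D (Z v) = Z (D v)" by (simp only: Z)
    with DZ'[of v] have "scale (q\<^sup>2 - 1) (Z (D v)) = 0" by (simp add: R.scale_left_diff_distrib)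
    then show ?thesis using R.q_sq_ne_1 by simp
  qed
  \<comment> \<open>Invertibility of \<open>z\<close> cancels it from
    \<open>Z (D v) = 0\<close>.\<close>
  moreover have "Zi (Z v) = v" "Zi 0 = 0" for v
    by (simp_all add: defs R.op_zinv R.endo_simps[OF R.linear_op])
  ultimately have D0: "D v = 0" for v by metis
  have "X = X'" using D0 by (auto simp: D_def)
  moreover have "Y = Y'" using aD D0 nz by (auto simp: fun_eq_iff)
  ultimately show ?thesis
    by (intro uq_module_structure_eqI[OF assms(1,2)]) (simp_all add: class_eqs SZ)
qed

text \<open>Uniqueness is asserted away from \<open>d = 1\<close>, \<open>q\<^sup>2 = -1\<close>,
  where it can fail, as the example with \<open>q = \<i>\<close> given after
  \<open>uq_module_structure\<close> shows.\<close>

theorem theorem1p4: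
  fixes q :: complex and d :: nat
    and scale :: "complex \<Rightarrow> 'v::ab_group_add \<Rightarrow> 'v"
    and A As :: "'v \<Rightarrow> 'v" and E Es :: "nat \<Rightarrow> 'v \<Rightarrow> 'v"
    and h hs \<kappa> \<kappa>s \<upsilon> \<epsilon> :: complex
  defines "good \<equiv> \<lambda>\<rho>. uq_module_structure scale q \<rho> \<and>
      (\<forall>v. A v = scale h v + scale (\<epsilon> * \<kappa>) (\<rho> (uq_x q) v) + scale (\<epsilon> * \<upsilon>) (\<rho> (uq_y q) v)) \<and>
      (\<forall>v. As v = scale hs v + scale (\<epsilon> * \<kappa>s) (\<rho> (uq_z q) v))"
  assumes "q \<noteq> 0" and "q\<^sup>2 \<noteq> 1"
    and "vector_space scale" and "vector_space.dim scale (UNIV :: 'v set) = d + 1"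
    and "leonard_system scale d A E As Es"
    and "dual_q_Krawtchouk scale q d A E As Es h hs \<kappa> \<kappa>s \<upsilon>"
    and "\<epsilon> \<in> {1, -1}"
  shows "(\<exists>\<rho>. good \<rho>) \<and> (\<not> (d = 1 \<and> q\<^sup>2 = -1) \<longrightarrow> (\<exists>!\<rho>. good \<rho>))"
proof -
  define th where "th i = eigenvalue_of scale A (E i)" for i
  define ths where "ths i = eigenvalue_of scale As (Es i)" for i
  interpret complex_space scale d
    by (intro complex_space.intro complex_vector_space.intro complex_space_axioms.intro) fact+
  note L = assms(6)[unfolded leonard_system_def]
  note K = assms(7)[unfolded dual_q_Krawtchouk_def]
  obtain w where "eigen_decomposition scale d A E th w"
    using eigen_decomposition_exists[of A E] L by (auto simp: th_def[abs_def])
  then interpret P: eigen_decomposition scale d A E th w .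
  obtain ws where "eigen_decomposition scale d As Es ths ws"
    using eigen_decomposition_exists[of As Es] L by (auto simp: ths_def[abs_def])
  then interpret D: eigen_decomposition scale d As Es ths ws .
  interpret split_system scale d A E th w As Es ths ws
  proof unfold_locales
    fix i j v assume "i \<le> d" "j \<le> d" "i + 1 < j"
    moreover from this have "\<bar>int i - int j\<bar> > 1" by simp
    ultimately have "E i \<circ> As \<circ> E j = (\<lambda>_. 0)" using L by simp
    from fun_cong[OF this, of v] show "E i (As (E j v)) = 0" by simp
  next
    fix i j v assume "i \<le> d" "j \<le> d" "j + 1 < i"
    moreover from this have "\<bar>int i - int j\<bar> > 1" by simp
    ultimately have "Es i \<circ> A \<circ> Es j = (\<lambda>_. 0)" using L by simp
    from fun_cong[OF this, of v] show "Es i (A (Es j v)) = 0" by simp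
  next
    fix i assume i: "Suc i \<le> d"
    moreover have "\<bar>int (Suc i) - int i\<bar> = 1" by simp
    ultimately have "Es (Suc i) \<circ> A \<circ> Es i \<noteq> (\<lambda>_. 0)" using L by simp
    then show "\<exists>v. Es (Suc i) (A (Es i v)) \<noteq> 0" by (auto simp: fun_eq_iff)
  qed
  have nz: "\<kappa> \<noteq> 0" "\<kappa>s \<noteq> 0" "\<upsilon> \<noteq> 0" "\<epsilon> \<noteq> 0" using K assms(8) by auto
  have ths_eq: "ths i = hs + \<kappa>s * q powi (int d - 2 * int i)" if "i \<le> d" for i
    using K that by (simp add: ths_def)
  obtain G where G: "uq_representation scale q G"
    "\<And>v. A v = scale h v + scale (\<epsilon> * \<kappa>) (G GenX v) + scale (\<epsilon> * \<upsilon>) (G GenY v)"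
    "\<And>v. As v = scale hs v + scale (\<epsilon> * \<kappa>s) (G GenZ v)"
    using uq_representation_exists[OF assms(2,3) nz(1,2) assms(8), of h \<upsilon> hs
        "first_split_seq scale d A E As Es"] K ths_eq As_u th_def ths_def
    by (auto simp del: u.simps)
  interpret G: uq_representation scale q G by fact
  have ex: "good G.rep"
    unfolding good_def using G.uq_module_structure_rep G(2,3) by (simp add: G.rep_gens)
  have non_deg: "q ^ 4 \<noteq> 1 \<or> (\<exists>e. \<forall>v. As v = scale e v)" if not_deg: "\<not> (d = 1 \<and> q\<^sup>2 = -1)"
  proof (rule disjCI)
    assume "\<not> (\<exists>e. \<forall>v. As v = scale e v)"
    show "q ^ 4 \<noteq> 1"
    proof
      assume q4: "q ^ 4 = 1"
      then have "(q\<^sup>2 - 1) * (q\<^sup>2 + 1) = 0" by (simp add: algebra_simps flip: power_add)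
      then have "q\<^sup>2 = -1" using assms(3) by (simp add: eq_neg_iff_add_eq_0)
      then consider "d = 0" | "d \<ge> 2" using not_deg by linarith
      then show False
      proof cases
        case 1
        \<comment> \<open>For \<open>d = 0\<close> the single idempotent is the identity.\<close>
        have "As v = scale (ths 0) v" for v
          using D.E_A[of 0 v] D.sum_E[of v] D.sum_E[of "As v"] 1 by simp
        then show False using \<open>\<not> (\<exists>e. \<forall>v. As v = scale e v)\<close> by blast
      next
        case 2
        \<comment> \<open>Passing from index 0 to index 2 divides the power of \<open>q\<close> by
          \<open>q ^ 4 = 1\<close>, so two eigenvalues of \<open>As\<close> would coincide.\<close>
        have "q powi (int d - 4) = q powi int d"
          using assms(2) q4 by (simp add: power_int_diff)
        then have "ths 0 = ths 2" using 2 by (simp add: ths_eq)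
        then show False using inj_onD[OF D.inj_th, of 0 2] 2 by simp
      qed
    qed
  qed
  have "\<rho> = \<sigma>" if "\<not> (d = 1 \<and> q\<^sup>2 = -1)" "good \<rho>" "good \<sigma>" for \<rho> \<sigma>
    by (rule uq_module_structure_unique[where q = q and scale = scale and A = A and As = As
          and h = h and hs = hs and a = "\<epsilon> * \<kappa>" and b = "\<epsilon> * \<upsilon>" and c = "\<epsilon> * \<kappa>s"])
      (use that(2,3) non_deg[OF that(1)] nz assms(2,3) in
        \<open>auto simp: good_def intro!: uq_module.intro uq_module_axioms.intro complex_vector_space_axioms\<close>)
  with ex show ?thesis by blast
qed

end
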